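(* Let $\mathcal T$ be a regular linear tessellation with activities $\pi_l\in(0,1)$, $k\ge2$ the number of colours, $\alpha_V\in[0,1]$, and let $\hat{\mathcal A}_\Phi$ be the whole-plane consistent polygonal field. Let $\theta\subset\mathbb R^2$ be a piecewise smooth simple closed curve containing no nodes of $\mathcal T$. Then the conditional distribution of $\hat{\mathcal A}_\Phi$ in the interior of $\theta$, given the configuration exterior to $\theta$, depends on that exterior configuration only through the intersections of $\theta$ with the edges of the polygonal field and through the colouring of the field along $\theta$.
   Context: Regular linear tessellation: a countable family $\mathcal T$ of straight lines in $\mathbb R^2$ such that no three lines of $\mathcal T$ meet at one point and every bounded set is hit by finitely many lines of $\mathcal T$. Each $l\in\mathcal T$ carries a fixed activity $\pi_l\in(0,1)$. Windows: bounded open convex sets $D\subseteq\mathbb R^2$ such that $\partial D$ contains no intersection point of two lines of $\mathcal T$ and every line of $\mathcal T$ hitting $\overline D$ meets $\partial D$ in exactly two points. $\mathcal T$ partitions $D$ into finitely many convex cells. Nodes are the intersection points $n(l_1,l_2)$ of two lines of $\mathcal T$; segments are the pieces of lines of $\mathcal T$ between consecutive nodes (possibly truncated by $\partial D$). Admissible configurations: assigning each cell a colour in $\{1,\dots,k\}$ gives a coloured planar graph $\hat\gamma$ in $\overline D$, whose underlying uncoloured graph $\gamma$ consists of all segments separating cells of different colours. The set $\hat\Gamma_D(\mathcal T)$ of admissible coloured polygonal configurations is the set of all coloured planar graphs with edges on lines of $\mathcal T$, interior vertices (in $D$) of degree 2, 3 or 4, boundary vertices (on $\partial D$) of degree 1,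 and no two adjacent faces (faces sharing an edge) of the same colour. It is in bijection with the colourings of the cells. A node lying inside a straight piece of $\gamma$ at which no other segment of $\gamma$ ends or passes is not a vertex. V-, T- and X-vertices are the interior vertices of degree 2, 3 and 4, and $N_V(\gamma),N_T(\gamma),N_X(\gamma)$ are their numbers. $E(\gamma)$ is the set of edges: maximal unions of connected collinear segments of $\gamma$ not broken by a vertex; edges are taken open. $E^*(\gamma)$ is the set of primary edges: maximal unions of connected collinear segments of $\gamma$ (possibly containing several edges because of T- or X-vertices). $l[e]$ is the line of $\mathcal T$ containing $e$. Consistent polygonal field: given $\alpha_V\in[0,1]$ put $\alpha_X=1-\alpha_V$, $\alpha_T=\frac12\bigl(1-\frac{k-2}{k-1}\alpha_X\bigr)$, $\epsilon=\frac{\alpha_V}{k-1}+\frac{k-2}{k-1}\alpha_T$, and $$\Phi_D(\hat\gamma)=-N_V(\gamma)\log\alpha_V-N_T(\gamma)\log((k-1)\alpha_T)-N_X(\gamma)\log((k-1)\alpha_X)+\mathrm{card}(E(\gamma))\log(k-1)$$ $$-\sum_{e\in E(\gamma)}\ \sum_{l\in\mathcal T,\,l\nsim e}\log(1-\epsilon\pi_l)+\sum_{n(l_1,l_2)\in\gamma}\log\Bigl(1-\frac{\alpha_V}{k-1}\pi_{l_1}\pi_{l_2}\Bigr),$$ with $0\times\infty=0$. Here $l\nsim e$ means that $l$ intersects the open edge $e$ but is not collinear with it, and $n(l_1,l_2)\in\gamma$ ranges over nodes lying on edges of $\gamma$ or coinciding with vertices of $\gamma$. The consistent polygonal field $\hat{\mathcal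 A}_{\Phi_D}$ is the random element of $\hat\Gamma_D(\mathcal T)$ with $\mathbb P(\hat{\mathcal A}_{\Phi_D}=\hat\gamma)\propto e^{-\Phi_D(\hat\gamma)}\prod_{e\in E^*(\gamma)}\pi_{l[e]}$. Whole-plane field: the fields $\hat{\mathcal A}_{\Phi_D}$ are consistent, i.e. for windows $D'\subseteq D$ the restriction $\hat{\mathcal A}_{\Phi_D}\cap D'$ has the law of $\hat{\mathcal A}_{\Phi_{D'}}$; by Kolmogorov's theorem there is a random coloured configuration $\hat{\mathcal A}_\Phi$ on $\mathbb R^2$ (with edges on lines of $\mathcal T$), unique in law, such that $\hat{\mathcal A}_\Phi\cap D$ has the law of $\hat{\mathcal A}_{\Phi_D}$ for every window $D$. *)

theory Defs
  imports "HOL-Probability.Probability"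
begin

type_synonym point = "real ^ 2"

section \<open>Tessellations and windows\<close>

definition regular_tessellation :: "point set set \<Rightarrow> bool" where
  "regular_tessellation T \<longleftrightarrow>
     countable T \<and>
     (\<forall>l\<in>T. affine l \<and> aff_dim l = 1) \<and>
     (\<forall>l1\<in>T. \<forall>l2\<in>T. \<forall>l3\<in>T. l1 \<noteq> l2 \<and> l1 \<noteq> l3 \<and> l2 \<noteq> l3 \<longrightarrow> l1 \<inter> l2 \<inter> l3 = {}) \<and>
     (\<forall>B. bounded B \<longrightarrow> finite {l \<in> T. l \<inter> B \<noteq> {}})"

definition nodes :: "point set set \<Rightarrow> point set" where
  "nodes T = {x. \<exists>l1\<in>T. \<exists>l2\<in>T. l1 \<noteq> l2 \<and> x \<in> l1 \<and> x \<in> l2}"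

definition window :: "point set set \<Rightarrow> point set \<Rightarrow> bool" where
  "window T D \<longleftrightarrow>
     bounded D \<and> open D \<and> convex D \<and>
     frontier D \<inter> nodes T = {} \<and>
     (\<forall>l\<in>T. l \<inter> closure D \<noteq> {} \<longrightarrow> card (l \<inter> frontier D) = 2)"

text \<open>In all of the following, \<open>D\<close> is a window or, for whole-plane configurations, \<open>UNIV\<close>.
  Cells and segments are open (segments relatively to their line).\<close>

definition cells :: "point set set \<Rightarrow> point set \<Rightarrow> point set set" where
  "cells T D = components (D - \<Union>T)"

definition segments :: "point set set \<Rightarrow> point set \<Rightarrow> point set set" where
  "segments T D = (\<Union>l\<in>T. components (l \<inter> D - nodes T))"

section \<open>Coloured polygonal configurations\<close>

text \<open>A coloured planar graph in \<open>D\<close> is encoded as a function on \<open>D\<close> (extensional, that is,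
  \<open>undefined\<close> outside \<open>D\<close>) whose value is \<open>None\<close> on the underlying uncoloured graph and
  \<open>Some c\<close> on the faces of colour \<open>c\<close>.  Restriction of a configuration to a smaller set is then
  restriction of functions.\<close>

type_synonym config = "point \<Rightarrow> nat option"

definition separating_segments ::
  "point set set \<Rightarrow> point set \<Rightarrow> (point set \<Rightarrow> nat) \<Rightarrow> point set set" where
  "separating_segments T D \<sigma> =
     {s \<in> segments T D. \<exists>C1\<in>cells T D. \<exists>C2\<in>cells T D.
        s \<subseteq> closure C1 \<and> s \<subseteq> closure C2 \<and> \<sigma> C1 \<noteq> \<sigma> C2}"

text \<open>A point off the graph that lies on a line of \<open>T\<close> has only cells of one and the same colour
  around it; it belongs to the face of that colour.\<close>

definition coloured_graph ::
  "point set set \<Rightarrow> point set \<Rightarrow> (point set \<Rightarrow> nat) \<Rightarrow> config" where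
  "coloured_graph T D \<sigma> =
     (\<lambda>x\<in>D. if x \<in> (\<Union>s\<in>separating_segments T D \<sigma>. closure s) then None
            else Some (THE c. \<exists>C\<in>cells T D. x \<in> closure C \<and> \<sigma> C = c))"

definition admissible :: "point set set \<Rightarrow> nat \<Rightarrow> point set \<Rightarrow> config set" where
  "admissible T k D = coloured_graph T D ` {\<sigma>. \<forall>C\<in>cells T D. \<sigma> C \<in> {1..k}}"

definition graph_of :: "point set \<Rightarrow> config \<Rightarrow> point set" where
  "graph_of D f = {x \<in> D. f x = None}"

section \<open>Vertices and edges of an uncoloured graph\<close>

definition graph_segments :: "point set set \<Rightarrow> point set \<Rightarrow> point set \<Rightarrow> point set set" where
  "graph_segments T D \<gamma> = {s \<in> segments T D. s \<subseteq> \<gamma>}"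

definition incident :: "point set set \<Rightarrow> point set \<Rightarrow> point set \<Rightarrow> point \<Rightarrow> point set set" where
  "incident T D \<gamma> n = {s \<in> graph_segments T D \<gamma>. n \<in> closure s}"

text \<open>Interior vertices: a node whose incident graph segments are all collinear lies inside a
  straight piece of the graph (or off the graph) and is not a vertex.\<close>

definition vertices :: "point set set \<Rightarrow> point set \<Rightarrow> point set \<Rightarrow> point set" where
  "vertices T D \<gamma> = {n \<in> nodes T \<inter> D. \<not> (\<exists>l\<in>T. \<forall>s\<in>incident T D \<gamma> n. s \<subseteq> l)}"

definition num_vertices :: "point set set \<Rightarrow> point set \<Rightarrow> point set \<Rightarrow> nat \<Rightarrow> nat" where
  "num_vertices T D \<gamma> d = card {n \<in> vertices T D \<gamma>. card (incident T D \<gamma> n) = d}"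

abbreviation "N_V T D \<gamma> \<equiv> num_vertices T D \<gamma> 2"
abbreviation "N_T T D \<gamma> \<equiv> num_vertices T D \<gamma> 3"
abbreviation "N_X T D \<gamma> \<equiv> num_vertices T D \<gamma> 4"

text \<open>This can be smaller than \<open>l \<inter> \<gamma>\<close>: the graph may cross \<open>l\<close> at a node without
  containing a segment of \<open>l\<close> there.\<close>

definition graph_on_line ::
  "point set set \<Rightarrow> point set \<Rightarrow> point set \<Rightarrow> point set \<Rightarrow> point set" where
  "graph_on_line T D \<gamma> l = D \<inter> (\<Union>s\<in>{s \<in> graph_segments T D \<gamma>. s \<subseteq> l}. closure s)"

definition edges :: "point set set \<Rightarrow> point set \<Rightarrow> point set \<Rightarrow> point set set" where
  "edges T D \<gamma> = (\<Union>l\<in>T. components (graph_on_line T D \<gamma> l - vertices T D \<gamma>))"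

definition primary_edges :: "point set set \<Rightarrow> point set \<Rightarrow> point set \<Rightarrow> point set set" where
  "primary_edges T D \<gamma> = (\<Union>l\<in>T. components (graph_on_line T D \<gamma> l))"

definition line_of :: "point set set \<Rightarrow> point set \<Rightarrow> point set" where
  "line_of T e = (THE l. l \<in> T \<and> e \<subseteq> l)"

definition crosses :: "point set \<Rightarrow> point set \<Rightarrow> bool" where
  "crosses l e \<longleftrightarrow> l \<inter> e \<noteq> {} \<and> \<not> e \<subseteq> l"

section \<open>The consistent polygonal field in a window\<close>

definition alpha_X :: "real \<Rightarrow> real" where
  "alpha_X \<alpha>V = 1 - \<alpha>V"

definition alpha_T :: "nat \<Rightarrow> real \<Rightarrow> real" where
  "alpha_T k \<alpha>V = (1 - (real k - 2) / (real k - 1) * alpha_X \<alpha>V) / 2"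

definition epsilon :: "nat \<Rightarrow> real \<Rightarrow> real" where
  "epsilon k \<alpha>V = \<alpha>V / (real k - 1) + (real k - 2) / (real k - 1) * alpha_T k \<alpha>V"

text \<open>Logarithm with \<open>log 0 = - \<infinity>\<close>; the convention \<open>0 * \<infinity> = 0\<close> is that of \<open>ereal\<close>.\<close>

definition elog :: "real \<Rightarrow> ereal" where
  "elog x = (if x = 0 then - \<infinity> else ereal (ln x))"

definition energy ::
  "point set set \<Rightarrow> (point set \<Rightarrow> real) \<Rightarrow> nat \<Rightarrow> real \<Rightarrow> point set \<Rightarrow> point set \<Rightarrow> ereal" where
  "energy T act k \<alpha>V D \<gamma> =
     - (ereal (real (N_V T D \<gamma>)) * elog \<alpha>V)
     - ereal (real (N_T T D \<gamma>)) * elog ((real k - 1) * alpha_T k \<alpha>V)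
     - ereal (real (N_X T D \<gamma>)) * elog ((real k - 1) * alpha_X \<alpha>V)
     + ereal (real (card (edges T D \<gamma>)) * ln (real k - 1))
     - ereal (\<Sum>e\<in>edges T D \<gamma>. \<Sum>l\<in>{l \<in> T. crosses l e}. ln (1 - epsilon k \<alpha>V * act l))
     + ereal (\<Sum>n\<in>nodes T \<inter> \<gamma>. ln (1 - \<alpha>V / (real k - 1) * (\<Prod>l\<in>{l \<in> T. n \<in> l}. act l)))"

text \<open>The energy never is \<open>- \<infinity>\<close>, and \<open>exp (- \<infinity>) = 0\<close>.\<close>

definition weight ::
  "point set set \<Rightarrow> (point set \<Rightarrow> real) \<Rightarrow> nat \<Rightarrow> real \<Rightarrow> point set \<Rightarrow> config \<Rightarrow> real" where
  "weight T act k \<alpha>V D f =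
     (let \<gamma> = graph_of D f; \<Phi> = energy T act k \<alpha>V D \<gamma> in
       (if \<Phi> = \<infinity> then 0 else exp (- real_of_ereal \<Phi>)) *
       (\<Prod>e\<in>primary_edges T D \<gamma>. act (line_of T e)))"

definition polygonal_field ::
  "point set set \<Rightarrow> (point set \<Rightarrow> real) \<Rightarrow> nat \<Rightarrow> real \<Rightarrow> point set \<Rightarrow> config measure" where
  "polygonal_field T act k \<alpha>V D =
     point_measure (admissible T k D)
       (\<lambda>f. ennreal (weight T act k \<alpha>V D f / (\<Sum>g\<in>admissible T k D. weight T act k \<alpha>V D g)))"

section \<open>The whole-plane field and its restrictions\<close>

definition whole_plane_field ::
  "point set set \<Rightarrow> (point set \<Rightarrow> real) \<Rightarrow> nat \<Rightarrow> real \<Rightarrow> 'w measure \<Rightarrow> ('w \<Rightarrow> config) \<Rightarrow> bool" where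
  "whole_plane_field T act k \<alpha>V M X \<longleftrightarrow>
     prob_space M \<and>
     X \<in> M \<rightarrow>\<^sub>M PiM UNIV (\<lambda>_. count_space UNIV) \<and>
     (\<forall>\<omega>\<in>space M. X \<omega> \<in> admissible T k UNIV) \<and>
     (\<forall>D. window T D \<longrightarrow>
        (\<lambda>\<omega>. restrict (X \<omega>) D) \<in> M \<rightarrow>\<^sub>M count_space (admissible T k D) \<and>
        distr M (count_space (admissible T k D)) (\<lambda>\<omega>. restrict (X \<omega>) D) =
          polygonal_field T act k \<alpha>V D)"

text \<open>The \<open>\<sigma>\<close>-algebra generated by the configuration in \<open>A\<close>.\<close>

definition config_algebra :: "'w measure \<Rightarrow> ('w \<Rightarrow> config) \<Rightarrow> point set \<Rightarrow> 'w measure" where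
  "config_algebra M X A =
     vimage_algebra (space M) (\<lambda>\<omega>. restrict (X \<omega>) A) (PiM A (\<lambda>_. count_space UNIV))"

text \<open>The \<open>\<sigma>\<close>-algebra generated by the intersections of \<open>A\<close> with the edges of the field and by
  the colours of the field along \<open>A\<close>.\<close>

definition trace_algebra ::
  "point set set \<Rightarrow> 'w measure \<Rightarrow> ('w \<Rightarrow> config) \<Rightarrow> point set \<Rightarrow> 'w measure" where
  "trace_algebra T M X A =
     sigma (space M)
       ({{\<omega> \<in> space M. x \<in> \<Union>(edges T UNIV (graph_of UNIV (X \<omega>)))} | x. x \<in> A} \<union>
        {{\<omega> \<in> space M. X \<omega> x = Some c} | x c. x \<in> A})"

end

(*
  Take a window D containing the curve K and its inside. Two admissible configurations f, f' in D
  that agree on K can exchange their inner parts: a cell that meets K has the same colour in both, and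
  a segment separating a cell inside K from a cell outside K would lie in K together with an end,
  which is a node. All terms of the energy are sums, over the nodes in D and the points where lines
  leave D, of functions of the germ of the graph, and K contains none of these points. Hence
  W f * W f' = W g * W g' for the exchanged configurations g, g'. Summing over pairs gives, for
  inner events A, outer events B determined in D and values t of the configuration on K,
  P(A, B, t) P(t) = P(A, t) P(B, t). A Dynkin argument extends this to all exterior events B. As only
  finitely many values t are possible, both conditional expectations are the sum over t of
  P(A, t) / P(t) times the indicator of t.
*)
theory Submission
  imports Defs
begin

section \<open>Local geometry of the tessellation\<close>

text \<open>The obstacle is that edges and primary edges are global objects: a component of the
  graph on a line can cross the curve many times, so the number of components does not visibly split
  into an inner and an outer part. Counting each component by one of its ends repairs this, since
  ends occur only at nodes and at points of the frontier of the window, all of them off the curve.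
  Products of weights of two pairs of configurations are compared, and not conditional densities:
  the weight then needs no factorisation into an inner and an outer factor, the normalising constant
  cancels, and weights equal to 0, which can occur for \<open>\<alpha>V = 0\<close> and
  \<open>\<alpha>V = 1\<close>, do no harm. For the same reason independence is kept as an identity
  between products, which makes sense also for traces of probability 0. At the end one formula is
  shown for every \<sigma>-algebra between that of the curve and that of the exterior, so that both
  conditional expectations are the same explicit function.\<close>

locale tessellation =
  fixes T :: "point set set"
  assumes regular: "regular_tessellation T"
begin

lemma line_affine: "l \<in> T \<Longrightarrow> affine l" and line_dim: "l \<in> T \<Longrightarrow> aff_dim l = 1"
  using regular by (auto simp: regular_tessellation_def)

lemma line_closed: "l \<in> T \<Longrightarrow> closed l"
  using closed_affine_hull[of l] line_affine[of l] by (simp add: hull_same)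

lemma no_three_concurrent:
  "\<lbrakk>l1 \<in> T; l2 \<in> T; l3 \<in> T; x \<in> l1; x \<in> l2; x \<in> l3; l1 \<noteq> l2; l1 \<noteq> l3\<rbrakk> \<Longrightarrow> l2 = l3"
  using regular unfolding regular_tessellation_def by blast

lemma finite_lines_hitting: "bounded B \<Longrightarrow> finite {l \<in> T. l \<inter> B \<noteq> {}}"
  using regular by (auto simp: regular_tessellation_def)

lemma line_eq_affine_hull:
  assumes "l \<in> T" "x \<in> l" "y \<in> l" "x \<noteq> y"
  shows "l = affine hull {x, y}"
proof -
  have "affine hull {x, y} \<subseteq> l"
    using assms by (simp add: hull_minimal line_affine)
  moreover have "aff_dim (affine hull {x, y}) = aff_dim l"
    using assms by (simp add: line_dim)
  ultimately show ?thesis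
    using affine_dim_equal[of "affine hull {x, y}" l] assms by (simp add: line_affine)
qed

lemma lines_meet_once:
  "\<lbrakk>l1 \<in> T; l2 \<in> T; x \<in> l1; x \<in> l2; y \<in> l1; y \<in> l2; x \<noteq> y\<rbrakk> \<Longrightarrow> l1 = l2"
  using line_eq_affine_hull by metis

text \<open>Unit speed makes the parametrisation an isometry, so that components on a line can later
  be counted on the real axis.\<close>

lemma line_param:
  assumes "l \<in> T"
  obtains a v :: point where "norm v = 1" "l = range (\<lambda>t::real. a + t *\<^sub>R v)"
proof -
  have "l \<noteq> {}" "\<not> (\<exists>x. l = {x})"
    using line_dim[OF assms] by auto
  then obtain x y where xy: "x \<in> l" "y \<in> l" "x \<noteq> y"
    by blast
  let ?v = "(y - x) /\<^sub>R norm (y - x)"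
  have "l = range (\<lambda>u. x + u *\<^sub>R (y - x))"
    using line_eq_affine_hull[OF assms xy] by (simp add: affine_hull_2_alt)
  also have "\<dots> = range (\<lambda>t. x + t *\<^sub>R ?v)"
  proof (intro equalityI subsetI; clarify)
    fix u :: real
    show "x + u *\<^sub>R (y - x) \<in> range (\<lambda>t. x + t *\<^sub>R ?v)"
      using xy by (intro image_eqI[of _ _ "u * norm (y - x)"]) auto
  next
    fix t :: real
    show "x + t *\<^sub>R ?v \<in> range (\<lambda>u. x + u *\<^sub>R (y - x))"
      by (intro image_eqI[of _ _ "t / norm (y - x)"]) (auto simp: divide_inverse)
  qed
  finally show ?thesis
    using that[of ?v x] xy by simp
qed

lemma line_unbounded:
  assumes "l \<in> T" shows "\<not> bounded l"
proof
  assume "bounded l"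
  obtain a v where v: "norm v = 1" and l: "l = range (\<lambda>t. a + t *\<^sub>R v)"
    using line_param[OF assms] .
  obtain B where "\<And>x. x \<in> l \<Longrightarrow> norm x \<le> B"
    using \<open>bounded l\<close> by (auto simp: bounded_iff)
  then have "norm (a + (norm a + \<bar>B\<bar> + 1) *\<^sub>R v) \<le> B"
    using l by blast
  moreover have "norm (a + (norm a + \<bar>B\<bar> + 1) *\<^sub>R v) \<ge> (norm a + \<bar>B\<bar> + 1) - norm a"
    using norm_triangle_ineq2[of "(norm a + \<bar>B\<bar> + 1) *\<^sub>R v" "- a"] v by (simp add: add.commute)
  ultimately show False by linarith
qed

lemma line_connected: "l \<in> T \<Longrightarrow> connected l"
  by (simp add: affine_imp_convex convex_connected line_affine)

lemma line_hyperplane: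
  assumes "l \<in> T"
  obtains n :: point and b where "n \<noteq> 0" "l = {y. n \<bullet> y = b}"
proof -
  have "aff_dim l = DIM(point) - 1"
    using line_dim[OF assms] by simp
  then show ?thesis
    using that hull_same[of affine l] line_affine[OF assms] unfolding aff_dim_eq_hyperplane by metis
qed

text \<open>Finitely many lines hit the unit ball around \<open>q\<close>; those missing
  \<open>q\<close> have a closed union, which a smaller ball avoids. Two lines through a node in
  that ball both pass through \<open>q\<close>, and distinct lines meet only once.\<close>

lemma local_ball:
  obtains \<delta> where "\<delta> > 0" "\<forall>l\<in>T. l \<inter> ball q \<delta> \<noteq> {} \<longrightarrow> q \<in> l" "nodes T \<inter> ball q \<delta> \<subseteq> {q}"
proof -
  let ?F = "{l \<in> T. l \<inter> ball q 1 \<noteq> {} \<and> q \<notin> l}"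
  have "finite ?F"
    by (rule finite_subset[OF _ finite_lines_hitting[OF bounded_ball[of q 1]]]) auto
  then have "closed (\<Union>?F)"
    by (intro closed_Union) (auto simp: line_closed)
  then have "open (ball q 1 - \<Union>?F)" "q \<in> ball q 1 - \<Union>?F"
    by (auto intro: open_Diff)
  then obtain \<delta> where \<delta>: "\<delta> > 0" "ball q \<delta> \<subseteq> ball q 1 - \<Union>?F"
    by (meson openE)
  have *: "\<forall>l\<in>T. l \<inter> ball q \<delta> \<noteq> {} \<longrightarrow> q \<in> l"
    using \<delta>(2) by blast
  have "nodes T \<inter> ball q \<delta> \<subseteq> {q}"
  proof
    fix y assume y: "y \<in> nodes T \<inter> ball q \<delta>"
    then obtain l1 l2 where l: "l1 \<in> T" "l2 \<in> T" "l1 \<noteq> l2" "y \<in> l1" "y \<in> l2"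
      by (auto simp: nodes_def)
    then have "q \<in> l1" "q \<in> l2"
      using * y by blast+
    then show "y \<in> {q}"
      using lines_meet_once[OF l(1,2)] l by blast
  qed
  with \<delta>(1) * show ?thesis
    by (rule that)
qed

lemma finite_nodes:
  assumes "bounded B" shows "finite (nodes T \<inter> B)"
proof -
  let ?F = "{l \<in> T. l \<inter> B \<noteq> {}}"
  have fin: "finite (l1 \<inter> l2)" if "l1 \<in> T" "l2 \<in> T" "l1 \<noteq> l2" for l1 l2
  proof (cases "l1 \<inter> l2 = {}")
    case False
    then obtain x where "x \<in> l1 \<inter> l2" by blast
    then have "l1 \<inter> l2 \<subseteq> {x}"
      using lines_meet_once that by blast
    then show ?thesis
      by (rule finite_subset) auto
  qed auto
  have "nodes T \<inter> B \<subseteq> (\<Union>l1\<in>?F. \<Union>l2\<in>?F - {l1}. l1 \<inter> l2)"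
    by (auto simp: nodes_def)
  moreover have "finite (\<Union>l1\<in>?F. \<Union>l2\<in>?F - {l1}. l1 \<inter> l2)"
    using finite_lines_hitting[OF assms] fin by (intro finite_UN_I) auto
  ultimately show ?thesis
    by (rule finite_subset)
qed

lemma segment_subset_line:
  assumes "s \<in> components (l \<inter> D - nodes T)" "l \<in> T"
  shows "closure s \<subseteq> l"
  using in_components_subset[OF assms(1)] by (intro closure_minimal) (auto simp: line_closed assms)

lemma segment_disjoint_nodes:
  assumes "s \<in> segments T D" shows "s \<inter> nodes T = {}" "s \<subseteq> D"
  using assms in_components_subset unfolding segments_def by blast+

lemma segmentE:
  assumes "s \<in> segments T D"
  obtains l where "l \<in> T" "s \<in> components (l \<inter> D - nodes T)" "closure s \<subseteq> l"
  using assms segment_subset_line unfolding segments_def by blast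

text \<open>A segment is a component of \<open>l \<inter> D - nodes T\<close> and hence closed in
  that set. So its closure adds only nodes and points outside \<open>D\<close>.\<close>

lemma closure_segment_nonnode:
  assumes "s \<in> segments T D" "x \<in> closure s" "x \<in> D" "x \<in> \<Union>T" "x \<notin> nodes T"
  shows "x \<in> s"
proof -
  obtain l where l: "l \<in> T" "s \<in> components (l \<inter> D - nodes T)" "closure s \<subseteq> l"
    using segmentE[OF assms(1)] .
  have "closedin (top_of_set (l \<inter> D - nodes T)) s"
    using closedin_component[OF l(2)] .
  then obtain C where "closed C" "s = (l \<inter> D - nodes T) \<inter> C"
    by (auto simp: closedin_closed)
  moreover from this have "closure s \<subseteq> C"
    by (intro closure_minimal) auto
  ultimately show ?thesis
    using l assms by blast
qed

lemma segments_eq: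
  assumes "s \<in> segments T D" "s' \<in> segments T D" "x \<in> s" "x \<in> s'"
  shows "s = s'"
proof -
  obtain l where l: "l \<in> T" "s \<in> components (l \<inter> D - nodes T)"
    using segmentE[OF assms(1)] .
  obtain l' where l': "l' \<in> T" "s' \<in> components (l' \<inter> D - nodes T)"
    using segmentE[OF assms(2)] .
  have "x \<in> l" "x \<in> l'" "x \<notin> nodes T"
    using l l' assms in_components_subset by blast+
  then have "l = l'"
    using l l' by (auto simp: nodes_def)
  then show ?thesis
    using l l' assms components_eq by blast
qed

lemma line_ball_connected: "l \<in> T \<Longrightarrow> connected (l \<inter> ball q \<delta>)"
  by (simp add: affine_imp_convex convex_Int convex_connected line_affine)

lemma nonnode_ball:
  assumes "open D" "x \<in> D" "x \<in> l" "l \<in> T" "x \<notin> nodes T"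
  obtains \<delta> where "\<delta> > 0" "ball x \<delta> \<subseteq> D" "\<Union>T \<inter> ball x \<delta> \<subseteq> l" "nodes T \<inter> ball x \<delta> = {}"
proof -
  obtain \<delta> where \<delta>: "\<delta> > 0" "\<forall>l\<in>T. l \<inter> ball x \<delta> \<noteq> {} \<longrightarrow> x \<in> l" "nodes T \<inter> ball x \<delta> \<subseteq> {x}"
    using local_ball[of x] by blast
  obtain \<epsilon> where \<epsilon>: "\<epsilon> > 0" "ball x \<epsilon> \<subseteq> D"
    using assms by (meson openE)
  have "l' = l" if "l' \<in> T" "l' \<inter> ball x (min \<delta> \<epsilon>) \<noteq> {}" for l'
  proof -
    have "l' \<inter> ball x \<delta> \<noteq> {}"
      using that by auto
    then show ?thesis
      using \<delta>(2) assms that(1) by (auto simp: nodes_def)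
  qed
  then have "\<Union>T \<inter> ball x (min \<delta> \<epsilon>) \<subseteq> l" by blast
  moreover have "ball x (min \<delta> \<epsilon>) \<subseteq> D" "nodes T \<inter> ball x (min \<delta> \<epsilon>) = {}" "min \<delta> \<epsilon> > 0"
    using \<delta> \<epsilon> assms(5) by auto
  ultimately show ?thesis
    using that by blast
qed

text \<open>A small disc around a nonnode meets only one line and contains no node, so segments are
  open in their lines.\<close>

lemma segment_through:
  assumes "open D" "x \<in> D" "x \<in> l" "l \<in> T" "x \<notin> nodes T"
  obtains s \<delta> where "s \<in> segments T D" "x \<in> s" "s \<subseteq> l" "\<delta> > 0" "l \<inter> ball x \<delta> \<subseteq> s"
proof -
  obtain \<delta> where \<delta>: "\<delta> > 0" "ball x \<delta> \<subseteq> D" "\<Union>T \<inter> ball x \<delta> \<subseteq> l" "nodes T \<inter> ball x \<delta> = {}"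
    using nonnode_ball[OF assms] .
  have sub: "l \<inter> ball x \<delta> \<subseteq> l \<inter> D - nodes T"
    using \<delta> by auto
  obtain s where s: "s \<in> components (l \<inter> D - nodes T)" "l \<inter> ball x \<delta> \<subseteq> s"
    using exists_component_superset[OF sub _ line_ball_connected] assms \<delta> by blast
  show ?thesis
  proof
    show "s \<in> segments T D"
      using s assms by (auto simp: segments_def)
    show "s \<subseteq> l"
      using s in_components_subset by blast
  qed (use s \<delta> assms in auto)
qed

end

section \<open>Exchanging the inner parts of two configurations\<close>

lemma graph_of_coloured_graph:
  "graph_of D (coloured_graph T D \<sigma>) = D \<inter> (\<Union>s\<in>separating_segments T D \<sigma>. closure s)"
  by (auto simp: graph_of_def coloured_graph_def)

text \<open>The only property of graphs of admissible configurations that the locality of the energy needs.\<close>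

definition segment_closed :: "point set set \<Rightarrow> point set \<Rightarrow> point set \<Rightarrow> bool" where
  "segment_closed T D \<gamma> \<longleftrightarrow> \<gamma> \<subseteq> D \<and> (\<forall>s\<in>segments T D. s \<inter> \<gamma> \<noteq> {} \<longrightarrow> s \<subseteq> \<gamma>)"

text \<open>Both branches of \<open>coloured_graph\<close> consult only cells whose closure contains
  \<open>x\<close>: if \<open>x\<close> lies in the closure of a segment, it lies in the closures of
  the two cells that the segment separates.\<close>

lemma coloured_graph_cong:
  assumes "\<And>C. \<lbrakk>C \<in> cells T D; x \<in> closure C\<rbrakk> \<Longrightarrow> \<sigma> C = \<tau> C"
  shows "coloured_graph T D \<sigma> x = coloured_graph T D \<tau> x"
proof -
  have "x \<in> (\<Union>s\<in>separating_segments T D \<sigma>. closure s) \<longleftrightarrow> x \<in> (\<Union>s\<in>separating_segments T D \<tau>. closure s)"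
  proof -
    have same: "\<sigma> C = \<tau> C" if "x \<in> closure s" "s \<subseteq> closure C" "C \<in> cells T D" for s C
      using assms[OF that(3)] that(1,2) closure_minimal[OF that(2)] by auto
    show ?thesis
    proof (intro iffI; elim UN_E)
      fix s assume s: "s \<in> separating_segments T D \<sigma>" "x \<in> closure s"
      then have "s \<in> separating_segments T D \<tau>"
        unfolding separating_segments_def mem_Collect_eq using same[OF s(2)] by metis
      then show "x \<in> (\<Union>s\<in>separating_segments T D \<tau>. closure s)"
        using s(2) by (rule UN_I)
    next
      fix s assume s: "s \<in> separating_segments T D \<tau>" "x \<in> closure s"
      then have "s \<in> separating_segments T D \<sigma>"
        unfolding separating_segments_def mem_Collect_eq using same[OF s(2)] by metis
      then show "x \<in> (\<Union>s\<in>separating_segments T D \<sigma>. closure s)"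
        using s(2) by (rule UN_I)
    qed
  qed
  moreover have "(\<exists>C\<in>cells T D. x \<in> closure C \<and> \<sigma> C = c) \<longleftrightarrow> (\<exists>C\<in>cells T D. x \<in> closure C \<and> \<tau> C = c)" for c
    using assms by auto
  ultimately show ?thesis
    by (simp add: coloured_graph_def)
qed

context tessellation
begin

text \<open>A point of a segment is no node. If it also lies in the closure of a separating segment,
  it lies in that segment itself, and two segments with a common point coincide.\<close>

lemma admissible_segment_closed:
  assumes "f \<in> admissible T k D"
  shows "segment_closed T D (graph_of D f)"
proof -
  obtain \<sigma> where f: "f = coloured_graph T D \<sigma>"
    using assms by (auto simp: admissible_def)
  have "s \<subseteq> graph_of D f" if s: "s \<in> segments T D" "s \<inter> graph_of D f \<noteq> {}" for s
  proof -
    obtain x s' where x: "x \<in> s" "s' \<in> separating_segments T D \<sigma>" "x \<in> closure s'"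
      using s by (auto simp: f graph_of_coloured_graph)
    have s': "s' \<in> segments T D"
      using x by (auto simp: separating_segments_def)
    obtain l where "l \<in> T" "closure s \<subseteq> l"
      using segmentE[OF s(1)] .
    then have "x \<in> \<Union>T"
      using x(1) closure_subset[of s] by blast
    then have "x \<in> s'"
      using closure_segment_nonnode[OF s' x(3)] segment_disjoint_nodes[OF s(1)] x(1) by blast
    then have "s = s'"
      using segments_eq s s' x by blast
    then show ?thesis
      using x(2) closure_subset segment_disjoint_nodes[OF s(1)] by (auto simp: f graph_of_coloured_graph)
  qed
  then show ?thesis
    by (auto simp: segment_closed_def graph_of_def)
qed

lemma open_complement_lines:
  assumes "open D" shows "open (D - \<Union>T)"
proof -
  have "\<exists>\<delta>>0. ball q \<delta> \<subseteq> D - \<Union>T" if q: "q \<in> D" "q \<notin> \<Union>T" for q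
  proof -
    obtain \<delta> where \<delta>: "\<delta> > 0" "\<forall>l\<in>T. l \<inter> ball q \<delta> \<noteq> {} \<longrightarrow> q \<in> l"
      "nodes T \<inter> ball q \<delta> \<subseteq> {q}"
      using local_ball[of q] by blast
    obtain \<epsilon> where \<epsilon>: "\<epsilon> > 0" "ball q \<epsilon> \<subseteq> D"
      using assms q by (meson openE)
    have "\<Union>T \<inter> ball q \<delta> = {}"
      using \<delta>(2) q(2) by blast
    moreover have "ball q (min \<delta> \<epsilon>) \<subseteq> ball q \<delta> \<inter> ball q \<epsilon>"
      by auto
    ultimately have "ball q (min \<delta> \<epsilon>) \<subseteq> D - \<Union>T"
      using \<epsilon>(2) by blast
    then show ?thesis
      using \<delta> \<epsilon> by (intro exI[of _ "min \<delta> \<epsilon>"]) auto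
  qed
  then show ?thesis
    by (auto simp: open_contains_ball)
qed

text \<open>Cells are open because the lines are locally finite and closed, so a cell meets the
  closure of another only if it meets the other itself.\<close>

lemma cell_eq:
  assumes "open D" "C \<in> cells T D" "C' \<in> cells T D" "x \<in> C" "x \<in> closure C'"
  shows "C' = C"
proof -
  have "open C"
    using assms open_complement_lines open_components by (auto simp: cells_def)
  then have "C \<inter> C' \<noteq> {}"
    using assms open_Int_closure_eq_empty by blast
  then show ?thesis
    using assms components_eq by (auto simp: cells_def)
qed

lemma coloured_graph_cell:
  assumes "open D" "C \<in> cells T D" "x \<in> C"
  shows "coloured_graph T D \<sigma> x = Some (\<sigma> C)"
proof -
  have "C \<subseteq> D - \<Union>T"
    using assms(2) in_components_subset unfolding cells_def by blast
  then have x: "x \<in> D" "x \<notin> \<Union>T"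
    using assms(3) by auto
  have "x \<notin> closure s" if "s \<in> separating_segments T D \<sigma>" for s
  proof -
    have "s \<in> segments T D"
      using that by (auto simp: separating_segments_def)
    then obtain l where "l \<in> T" "closure s \<subseteq> l"
      using segmentE by metis
    then show ?thesis
      using x by blast
  qed
  moreover have "(THE c. \<exists>C\<in>cells T D. x \<in> closure C \<and> \<sigma> C = c) = \<sigma> C"
  proof (rule the_equality)
    show "\<exists>C'\<in>cells T D. x \<in> closure C' \<and> \<sigma> C' = \<sigma> C"
      using assms(2,3) closure_subset[of C] by blast
    fix c assume "\<exists>C'\<in>cells T D. x \<in> closure C' \<and> \<sigma> C' = c"
    then show "c = \<sigma> C"
      using cell_eq[OF assms(1,2) _ assms(3)] by blast
  qed
  ultimately show ?thesis
    using x by (auto simp: coloured_graph_def)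
qed

text \<open>The line cuts a small disc around a nonnode into two open half discs that no line meets.
  Each of them lies in one cell and has the diameter in its closure, and every cell that comes near
  \<open>x\<close> enters one of them.\<close>

lemma cells_at_line_point:
  assumes "open D" "x \<in> D" "x \<in> l" "l \<in> T" "x \<notin> nodes T"
  obtains C1 C2 \<delta> where "C1 \<in> cells T D" "C2 \<in> cells T D" "\<delta> > 0"
    "l \<inter> ball x \<delta> \<subseteq> closure C1" "l \<inter> ball x \<delta> \<subseteq> closure C2"
    "\<forall>C\<in>cells T D. x \<in> closure C \<longrightarrow> C = C1 \<or> C = C2"
proof -
  obtain \<delta> where \<delta>: "\<delta> > 0" "ball x \<delta> \<subseteq> D" "\<Union>T \<inter> ball x \<delta> \<subseteq> l"
    by (rule nonnode_ball[OF assms])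
  obtain n b where n: "n \<noteq> 0" "l = {y. n \<bullet> y = b}"
    using line_hyperplane[OF assms(4)] by blast
  let ?H1 = "ball x \<delta> \<inter> {y. n \<bullet> y > b}" and ?H2 = "ball x \<delta> \<inter> {y. n \<bullet> y < b}"
  have cl: "l \<inter> ball x \<delta> \<subseteq> closure ?H1" "l \<inter> ball x \<delta> \<subseteq> closure ?H2"
    using open_Int_closure_subset[OF open_ball, of x \<delta> "{y. n \<bullet> y > b}"]
      open_Int_closure_subset[OF open_ball, of x \<delta> "{y. n \<bullet> y < b}"] n
    by (auto simp: closure_halfspace_gt closure_halfspace_lt)
  have ne: "?H1 \<noteq> {}" "?H2 \<noteq> {}"
    using cl assms(3) \<delta>(1) by (metis IntI centre_in_ball closure_empty empty_iff subsetD)+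
  have "connected ?H1" "connected ?H2"
    by (auto intro!: convex_connected convex_Int convex_halfspace_gt convex_halfspace_lt)
  moreover have sub: "?H1 \<subseteq> D - \<Union>T" "?H2 \<subseteq> D - \<Union>T"
    using \<delta> n by auto
  ultimately obtain C1 C2 where C: "C1 \<in> cells T D" "?H1 \<subseteq> C1" "C2 \<in> cells T D" "?H2 \<subseteq> C2"
    using exists_component_superset[OF sub(1)] exists_component_superset[OF sub(2)] ne
    unfolding cells_def by (metis subset_empty)
  show ?thesis
  proof
    show "l \<inter> ball x \<delta> \<subseteq> closure C1" "l \<inter> ball x \<delta> \<subseteq> closure C2"
      using cl C closure_mono by blast+
    show "\<forall>C\<in>cells T D. x \<in> closure C \<longrightarrow> C = C1 \<or> C = C2"
    proof (intro ballI impI)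
      fix C assume C': "C \<in> cells T D" "x \<in> closure C"
      then have "ball x \<delta> \<inter> C \<noteq> {}"
        using \<delta>(1) open_Int_closure_eq_empty[OF open_ball] by (metis IntI centre_in_ball empty_iff)
      then obtain y where y: "y \<in> ball x \<delta>" "y \<in> C" by blast
      have "C \<subseteq> D - \<Union>T"
        using C'(1) in_components_subset unfolding cells_def by blast
      then have "y \<notin> l"
        using y assms(4) by blast
      then have "y \<in> C1 \<or> y \<in> C2"
        using y C n by (auto simp: neq_iff)
      then show "C = C1 \<or> C = C2"
        using y C C'(1) components_eq unfolding cells_def by blast
    qed
  qed (use C \<delta> in auto)
qed

text \<open>At each point of the segment only two cells are near, and both have a whole
  neighbourhood on the line in their closures. So \<open>s \<inter> closure C\<close> is open and
  closed in the connected set \<open>s\<close>.\<close>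

lemma segment_subset_closure_cell:
  assumes "open D" "s \<in> segments T D" "C \<in> cells T D" "x \<in> s" "x \<in> closure C"
  shows "s \<subseteq> closure C"
proof -
  obtain l where l: "l \<in> T" "s \<in> components (l \<inter> D - nodes T)" "closure s \<subseteq> l"
    using segmentE[OF assms(2)] .
  have sl: "s \<subseteq> l \<inter> D - nodes T"
    using l in_components_subset by blast
  have "openin (top_of_set s) (s \<inter> closure C)"
    unfolding openin_contains_ball
  proof (intro conjI ballI)
    fix y assume y: "y \<in> s \<inter> closure C"
    then have "y \<in> D" "y \<in> l" "y \<notin> nodes T"
      using sl by auto
    obtain C1 C2 \<delta> where \<delta>: "C1 \<in> cells T D" "C2 \<in> cells T D" "\<delta> > 0"
      "l \<inter> ball y \<delta> \<subseteq> closure C1" "l \<inter> ball y \<delta> \<subseteq> closure C2"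
      "\<forall>C\<in>cells T D. y \<in> closure C \<longrightarrow> C = C1 \<or> C = C2"
      using cells_at_line_point[OF assms(1) \<open>y \<in> D\<close> \<open>y \<in> l\<close> l(1) \<open>y \<notin> nodes T\<close>] by blast
    have "C = C1 \<or> C = C2"
      using \<delta>(6) assms(3) y by blast
    then have "l \<inter> ball y \<delta> \<subseteq> closure C" "\<delta> > 0"
      using \<delta> by auto
    then show "\<exists>e>0. ball y e \<inter> s \<subseteq> s \<inter> closure C"
      using sl by blast
  qed auto
  moreover have "closedin (top_of_set s) (s \<inter> closure C)"
    by (simp add: closedin_closed_Int)
  moreover have "connected s"
    using l in_components_connected by blast
  ultimately have "s \<inter> closure C = {} \<or> s \<inter> closure C = s"
    using connected_clopen by blast
  then show ?thesis
    using assms by blast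
qed

text \<open>Whether \<open>x\<close> is on the graph is a question about the two cells at
  \<open>x\<close> alone, because cells that share the point \<open>x\<close> of a segment share the
  whole segment.\<close>

lemma coloured_graph_line_point:
  assumes "open D" "x \<in> D" "x \<in> l" "l \<in> T" "x \<notin> nodes T"
    and "C1 \<in> cells T D" "C2 \<in> cells T D" "x \<in> closure C1" "x \<in> closure C2"
    and all: "\<forall>C\<in>cells T D. x \<in> closure C \<longrightarrow> C = C1 \<or> C = C2"
  shows "coloured_graph T D \<sigma> x = (if \<sigma> C1 = \<sigma> C2 then Some (\<sigma> C1) else None)"
proof -
  obtain s where s: "s \<in> segments T D" "x \<in> s"
    using segment_through[OF assms(1-5)] by blast
  have sep: "x \<in> (\<Union>s\<in>separating_segments T D \<sigma>. closure s) \<longleftrightarrow> \<sigma> C1 \<noteq> \<sigma> C2"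
  proof
    assume "x \<in> (\<Union>s\<in>separating_segments T D \<sigma>. closure s)"
    then obtain s' C C' where "x \<in> closure s'" "C \<in> cells T D" "C' \<in> cells T D"
      "s' \<subseteq> closure C" "s' \<subseteq> closure C'" and neq: "\<sigma> C \<noteq> \<sigma> C'"
      by (auto simp: separating_segments_def)
    then have "x \<in> closure C" "x \<in> closure C'"
      by (meson closure_minimal closed_closure subsetD)+
    then have "C = C1 \<or> C = C2" "C' = C1 \<or> C' = C2"
      using all \<open>C \<in> cells T D\<close> \<open>C' \<in> cells T D\<close> by auto
    then show "\<sigma> C1 \<noteq> \<sigma> C2"
      using neq by auto
  next
    assume "\<sigma> C1 \<noteq> \<sigma> C2"
    then have "s \<in> separating_segments T D \<sigma>"
      unfolding separating_segments_def
      using s segment_subset_closure_cell[OF assms(1) s(1)] assms(6-9) by blast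
    then show "x \<in> (\<Union>s\<in>separating_segments T D \<sigma>. closure s)"
      using s closure_subset by blast
  qed
  show ?thesis
  proof (cases "\<sigma> C1 = \<sigma> C2")
    case True
    then have "(THE c. \<exists>C\<in>cells T D. x \<in> closure C \<and> \<sigma> C = c) = \<sigma> C1"
      using assms(6-9) all by (intro the_equality) force+
    then show ?thesis
      using True sep assms(2) by (simp add: coloured_graph_def)
  next
    case False
    then show ?thesis
      using sep assms(2) by (simp add: coloured_graph_def)
  qed
qed

text \<open>The closure of \<open>s\<close> would stay in \<open>K\<close>, hence in
  \<open>D\<close> and away from nodes, so \<open>s\<close> would have no end. It would then be open
  and closed in its line and thus equal to it, but lines are unbounded.\<close>

lemma no_segment_in_compact:
  assumes "open D" "s \<in> segments T D" "s \<subseteq> K" "compact K" "K \<subseteq> D" "K \<inter> nodes T = {}"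
  shows False
proof -
  obtain l where l: "l \<in> T" "s \<in> components (l \<inter> D - nodes T)" "closure s \<subseteq> l"
    using segmentE[OF assms(2)] .
  have sl: "s \<subseteq> l \<inter> D - nodes T"
    using l in_components_subset by blast
  have "closure s \<subseteq> K"
    using assms by (simp add: closure_minimal compact_imp_closed)
  then have "closure s \<subseteq> s"
    using closure_segment_nonnode[OF assms(2)] assms(5,6) l by blast
  then have "closed s"
    using closure_subset_eq by blast
  then have "closedin (top_of_set l) s"
    using sl by (auto intro: closed_subset)
  moreover have "openin (top_of_set l) s"
    unfolding openin_contains_ball
  proof (intro conjI ballI)
    fix y assume y: "y \<in> s"
    then have "y \<in> D" "y \<in> l" "y \<notin> nodes T"
      using sl by auto
    then obtain s' \<delta> where "s' \<in> segments T D" "y \<in> s'" "\<delta> > 0" "l \<inter> ball y \<delta> \<subseteq> s'"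
      using segment_through[of D y l] assms(1) l(1) by metis
    moreover from this have "s' = s"
      using segments_eq assms(2) y by blast
    ultimately show "\<exists>e>0. ball y e \<inter> l \<subseteq> s"
      by blast
  qed (use sl in auto)
  ultimately have "s = {} \<or> s = l"
    using connected_clopen line_connected[OF l(1)] by blast
  then have "s = l"
    using in_components_nonempty l(2) by blast
  then show False
    using line_unbounded[OF l(1)] assms(3,4) bounded_subset compact_imp_bounded by blast
qed

text \<open>The exchange is done on colourings of cells, which makes the result admissible by
  construction. A cell meeting \<open>K\<close> has the same colour in both colourings, and every
  other cell lies on one side of \<open>K\<close>. Near points off \<open>K\<close> the new
  colouring is therefore one of the two old ones; the delicate points are those of \<open>K\<close>
  on a line.\<close>

lemma coloured_graph_swap:
  assumes "open D" "compact K" "K \<subseteq> D" "K \<inter> nodes T = {}"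
    and eq: "\<And>x. x \<in> K \<Longrightarrow> coloured_graph T D \<sigma> x = coloured_graph T D \<sigma>' x"
  shows "coloured_graph T D (\<lambda>C. if C \<subseteq> outside K then \<sigma>' C else \<sigma> C) =
    (\<lambda>x\<in>D. if x \<in> inside K then coloured_graph T D \<sigma> x else coloured_graph T D \<sigma>' x)"
    (is "coloured_graph T D ?\<tau> = ?g")
proof
  have cK: "closed K"
    by (simp add: assms compact_imp_closed)
  have split: "C \<inter> K \<noteq> {} \<or> C \<subseteq> inside K \<or> C \<subseteq> outside K" if "C \<in> cells T D" for C
  proof -
    have "connected C"
      using that by (auto simp: cells_def in_components_connected)
    then show ?thesis
      using connectedD[of C "inside K" "outside K"] open_inside[OF cK] open_outside[OF cK]
        inside_Int_outside[of K] inside_Un_outside[of K] by blast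
  qed
  \<comment> \<open>At a point of an open cell the configuration shows the colour of that
    cell.\<close>
  have agree: "\<sigma> C = \<sigma>' C" if "C \<in> cells T D" "C \<inter> K \<noteq> {}" for C
    using that eq coloured_graph_cell[OF assms(1) that(1)] by fastforce
  have meets: "C \<inter> U \<noteq> {}" if "x \<in> U" "open U" "x \<in> closure C" for C U and x :: point
    using that open_Int_closure_eq_empty by (metis IntI empty_iff inf_commute)
  fix x
  consider "x \<notin> D" | "x \<in> inside K" "x \<in> D" | "x \<in> outside K" "x \<in> D" | "x \<in> K" "x \<in> D" "x \<notin> \<Union>T"
    | l where "x \<in> K" "x \<in> D" "x \<in> l" "l \<in> T"
    using inside_Un_outside[of K] by blast
  then show "coloured_graph T D ?\<tau> x = ?g x"
  proof cases
    case 1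
    then show ?thesis by (simp add: coloured_graph_def)
  next
    case 2
    have "?\<tau> C = \<sigma> C" if "C \<in> cells T D" "x \<in> closure C" for C
    proof -
      have "\<not> C \<subseteq> outside K"
        using meets[OF 2(1) open_inside[OF cK] that(2)] inside_Int_outside[of K] by blast
      then show ?thesis by simp
    qed
    then have "coloured_graph T D ?\<tau> x = coloured_graph T D \<sigma> x"
      by (intro coloured_graph_cong) auto
    then show ?thesis
      using 2 by simp
  next
    case 3
    have "?\<tau> C = \<sigma>' C" if "C \<in> cells T D" "x \<in> closure C" for C
    proof -
      have "\<not> C \<subseteq> inside K"
        using meets[OF 3(1) open_outside[OF cK] that(2)] inside_Int_outside[of K] by blast
      then have "C \<subseteq> outside K \<or> \<sigma> C = \<sigma>' C"
        using split[OF that(1)] agree[OF that(1)] by blast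
      then show ?thesis by auto
    qed
    then have "coloured_graph T D ?\<tau> x = coloured_graph T D \<sigma>' x"
      by (intro coloured_graph_cong) auto
    moreover have "x \<notin> inside K"
      using 3 inside_Int_outside[of K] by blast
    ultimately show ?thesis
      using 3 by simp
  next
    case 4
    then obtain C where C: "C \<in> cells T D" "x \<in> C"
      using Union_components[of "D - \<Union>T"] unfolding cells_def by blast
    then have "?\<tau> C = \<sigma>' C"
      using agree[OF C(1)] 4 by auto
    moreover have "x \<notin> inside K"
      using 4 inside_no_overlap[of K] by blast
    ultimately show ?thesis
      using 4 C coloured_graph_cell[OF assms(1) C] by simp
  next
    case 5
    have nn: "x \<notin> nodes T"
      using 5 assms(4) by blast
    obtain C1 C2 \<delta> where C: "C1 \<in> cells T D" "C2 \<in> cells T D" "\<delta> > 0"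
      "l \<inter> ball x \<delta> \<subseteq> closure C1" "l \<inter> ball x \<delta> \<subseteq> closure C2"
      and all: "\<forall>C\<in>cells T D. x \<in> closure C \<longrightarrow> C = C1 \<or> C = C2"
      using cells_at_line_point[OF assms(1) 5(2-4) nn] by blast
    have x: "x \<in> closure C1" "x \<in> closure C2"
      using C 5 by auto
    note val = coloured_graph_line_point[OF assms(1) 5(2-4) nn C(1,2) x all]
    \<comment> \<open>a segment between an inner and an outer cell would lie in \<open>K\<close>, and so would its end, a node\<close>
    have not_mixed: False if "C \<in> cells T D" "C' \<in> cells T D" "x \<in> closure C" "x \<in> closure C'"
      "C \<subseteq> inside K" "C' \<subseteq> outside K" for C C'
    proof -
      obtain s where s: "s \<in> segments T D" "x \<in> s"
        using segment_through[OF assms(1) 5(2-4) nn] by blast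
      have "s \<subseteq> closure C" "s \<subseteq> closure C'"
        using segment_subset_closure_cell[OF assms(1) s(1) _ s(2)] that by auto
      moreover have "closure C \<subseteq> K \<union> inside K" "closure C' \<subseteq> K \<union> outside K"
        using closure_mono[OF that(5)] closure_mono[OF that(6)]
          closure_inside_subset[OF cK] closure_outside_subset[OF cK] by auto
      ultimately have "s \<subseteq> K"
        using inside_Int_outside[of K] by blast
      then show False
        using no_segment_in_compact[OF assms(1) s(1) _ assms(2-4)] by blast
    qed
    have io: "C \<subseteq> inside K \<Longrightarrow> \<not> C \<subseteq> outside K" if "C \<in> cells T D" for C
      using in_components_nonempty that inside_Int_outside[of K] unfolding cells_def by blast
    define \<tau> where "\<tau> = ?\<tau>"
    have cases: "\<sigma> C = \<sigma>' C \<and> \<tau> C = \<sigma>' C \<or> C \<subseteq> inside K \<and> \<tau> C = \<sigma> C \<or> C \<subseteq> outside K \<and> \<tau> C = \<sigma>' C"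
      if "C \<in> cells T D" for C
      using split[OF that] agree[OF that] io[OF that] unfolding \<tau>_def by metis
    \<comment> \<open>With an inner cell and an outer cell excluded as neighbours,
      \<open>\<tau>\<close> agrees on both cells at \<open>x\<close> with \<open>\<sigma>\<close> or
      on both with \<open>\<sigma>'\<close>, and these two give the same value at
      \<open>x \<in> K\<close>.\<close>
    have "coloured_graph T D \<tau> x = coloured_graph T D \<sigma>' x"
      using cases[OF C(1)] cases[OF C(2)] eq[OF 5(1)]
        not_mixed[OF C(1,2) x] not_mixed[OF C(2,1) x(2,1)]
      unfolding val by (elim disjE conjE) (simp_all split: if_split_asm)
    then show ?thesis
      using 5 eq by (simp add: \<tau>_def)
  qed
qed

lemma admissible_swap:
  assumes "open D" "compact K" "K \<subseteq> D" "K \<inter> nodes T = {}"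
    and f: "f \<in> admissible T k D" and f': "f' \<in> admissible T k D" and eq: "restrict f K = restrict f' K"
  shows "(\<lambda>x\<in>D. if x \<in> inside K then f x else f' x) \<in> admissible T k D"
proof -
  obtain \<sigma> \<sigma>' where \<sigma>: "f = coloured_graph T D \<sigma>" "\<forall>C\<in>cells T D. \<sigma> C \<in> {1..k}"
    "f' = coloured_graph T D \<sigma>'" "\<forall>C\<in>cells T D. \<sigma>' C \<in> {1..k}"
    using f f' unfolding admissible_def by blast
  have "\<And>x. x \<in> K \<Longrightarrow> coloured_graph T D \<sigma> x = coloured_graph T D \<sigma>' x"
    using eq \<sigma> by (metis restrict_apply')
  from coloured_graph_swap[OF assms(1-4) this] show ?thesis
    unfolding admissible_def using \<sigma> by (intro image_eqI[of _ _ "\<lambda>C. if C \<subseteq> outside K then \<sigma>' C else \<sigma> C"]) auto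
qed

end

section \<open>Locality of the energy\<close>

text \<open>The numbers of edges and of primary edges on a line are numbers of connected components.
  Counting a component by its left end turns them into sums of germ-dependent terms.\<close>

definition left_ends :: "real set \<Rightarrow> real set" where
  "left_ends S = {t. (\<exists>\<delta>>0. {t<..<t + \<delta>} \<subseteq> S) \<and> \<not> (\<exists>\<delta>>0. {t - \<delta><..<t + \<delta>} \<subseteq> S)}"

lemma left_ends_local:
  assumes "open V" "t \<in> V" "A \<inter> V = B \<inter> V"
  shows "t \<in> left_ends A \<longleftrightarrow> t \<in> left_ends B"
proof -
  obtain \<epsilon> where \<epsilon>: "\<epsilon> > 0" "{t - \<epsilon><..<t + \<epsilon>} \<subseteq> V"
    using assms(1,2) unfolding open_contains_ball by (metis ball_eq_greaterThanLessThan)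
  \<comment> \<open>Both conditions in \<open>left_ends\<close> ask for some positive radius, which
    may be shrunk to at most \<open>\<epsilon>\<close>, so they can be tested inside
    \<open>V\<close>.\<close>
  have 1: "(\<exists>\<delta>>0. {t<..<t + \<delta>} \<subseteq> S) \<longleftrightarrow> (\<exists>\<delta>>0. {t<..<t + \<delta>} \<subseteq> S \<inter> V)" for S
  proof
    assume "\<exists>\<delta>>0. {t<..<t + \<delta>} \<subseteq> S"
    then obtain \<delta> where \<delta>: "\<delta> > 0" "{t<..<t + \<delta>} \<subseteq> S" by blast
    have "{t<..<t + min \<delta> \<epsilon>} \<subseteq> {t<..<t + \<delta>} \<inter> {t - \<epsilon><..<t + \<epsilon>}"
      using \<epsilon>(1) by auto
    then show "\<exists>\<delta>>0. {t<..<t + \<delta>} \<subseteq> S \<inter> V"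
      using \<delta> \<epsilon> by (intro exI[of _ "min \<delta> \<epsilon>"]) (blast intro: min_less_iff_conj[THEN iffD2])
  qed blast
  have 2: "(\<exists>\<delta>>0. {t - \<delta><..<t + \<delta>} \<subseteq> S) \<longleftrightarrow> (\<exists>\<delta>>0. {t - \<delta><..<t + \<delta>} \<subseteq> S \<inter> V)" for S
  proof
    assume "\<exists>\<delta>>0. {t - \<delta><..<t + \<delta>} \<subseteq> S"
    then obtain \<delta> where \<delta>: "\<delta> > 0" "{t - \<delta><..<t + \<delta>} \<subseteq> S" by blast
    have "{t - min \<delta> \<epsilon><..<t + min \<delta> \<epsilon>} \<subseteq> {t - \<delta><..<t + \<delta>} \<inter> {t - \<epsilon><..<t + \<epsilon>}"
      by auto
    then show "\<exists>\<delta>>0. {t - \<delta><..<t + \<delta>} \<subseteq> S \<inter> V"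
      using \<delta> \<epsilon> by (intro exI[of _ "min \<delta> \<epsilon>"]) (blast intro: min_less_iff_conj[THEN iffD2])
  qed blast
  show ?thesis
    unfolding left_ends_def mem_Collect_eq by (subst (1 2) 1, subst (1 2) 2) (simp only: assms(3))
qed

text \<open>A component with two points contains an interval just to the right of its infimum, and
  this interval determines it. A component consisting of one point would have no left end in the
  sense of \<open>left_ends\<close>, hence the assumption \<open>nondeg\<close>. Conversely, the
  component that starts at a left end cannot reach further to the left, as it would then contain a
  two-sided neighbourhood of that end.\<close>

lemma bij_betw_Inf_components:
  fixes S :: "real set"
  assumes "bdd_below S" and nondeg: "\<And>e. e \<in> components S \<Longrightarrow> \<exists>x\<in>e. \<exists>y\<in>e. x < y"
  shows "bij_betw Inf (components S) (left_ends S)"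
proof -
  have bdd: "bdd_below e" if "e \<in> components S" for e
    using that assms(1) bdd_below_mono in_components_subset by metis
  have after: "\<exists>\<delta>>0. {Inf e<..<Inf e + \<delta>} \<subseteq> e" if e: "e \<in> components S" for e
  proof -
    obtain x y where xy: "x \<in> e" "y \<in> e" "x < y"
      using nondeg[OF e] by blast
    have "Inf e \<le> x"
      using bdd[OF e] xy by (simp add: cInf_lower)
    have "z \<in> e" if z: "Inf e < z" "z < y" for z
    proof -
      obtain w where "w \<in> e" "w < z"
        using z(1) bdd[OF e] xy by (metis cInf_less_iff empty_iff)
      then show ?thesis
        using xy z(2) in_components_connected[OF e] unfolding connected_iff_interval
        by (meson less_imp_le)
    qed
    then show ?thesis
      using xy \<open>Inf e \<le> x\<close> by (intro exI[of _ "y - Inf e"]) auto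
  qed
  have meet: "{s<..<s + (\<delta>::real)} \<inter> {s<..<s + \<delta>'} \<noteq> {}" if "\<delta> > 0" "\<delta>' > 0" for s \<delta> \<delta>'
  proof -
    have "s + min \<delta> \<delta>' / 2 \<in> {s<..<s + \<delta>} \<inter> {s<..<s + \<delta>'}"
      using that by (auto simp: min_def)
    then show ?thesis by blast
  qed
  show ?thesis
    unfolding bij_betw_def
  proof (intro conjI equalityI subsetI)
    show "inj_on Inf (components S)"
    proof (rule inj_onI)
      fix e e' assume e: "e \<in> components S" "e' \<in> components S" "Inf e = Inf e'"
      obtain \<delta> \<delta>' where "\<delta> > 0" "{Inf e<..<Inf e + \<delta>} \<subseteq> e" "\<delta>' > 0" "{Inf e<..<Inf e + \<delta>'} \<subseteq> e'"
        using after[OF e(1)] after[OF e(2)] e(3) by metis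
      then have "e \<inter> e' \<noteq> {}"
        using meet[of \<delta> \<delta>' "Inf e"] by blast
      then show "e = e'"
        using components_eq e by blast
    qed
  next
    fix q assume "q \<in> Inf ` components S"
    then obtain e where e: "e \<in> components S" "q = Inf e" by blast
    obtain \<delta> where \<delta>: "\<delta> > 0" "{q<..<q + \<delta>} \<subseteq> e"
      using after[OF e(1)] e(2) by blast
    have "\<not> {q - \<delta>'<..<q + \<delta>'} \<subseteq> S" if "\<delta>' > 0" for \<delta>'
    proof
      assume sub: "{q - \<delta>'<..<q + \<delta>'} \<subseteq> S"
      have "e \<inter> {q - \<delta>'<..<q + \<delta>'} \<noteq> {}"
        using meet[OF \<delta>(1) that, of q] \<delta>(2) that by fastforce
      then have "{q - \<delta>'<..<q + \<delta>'} \<subseteq> e"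
        using components_maximal[OF e(1) _ sub] by (simp add: connected_Ioo)
      then have "q - \<delta>' / 2 \<in> e"
        using that by auto
      then show False
        using cInf_lower[OF _ bdd[OF e(1)]] e(2) that by fastforce
    qed
    moreover have "{q<..<q + \<delta>} \<subseteq> S"
      using \<delta> e in_components_subset by blast
    ultimately show "q \<in> left_ends S"
      using \<delta>(1) by (auto simp: left_ends_def)
  next
    fix q assume q: "q \<in> left_ends S"
    then obtain \<delta> where \<delta>: "\<delta> > 0" "{q<..<q + \<delta>} \<subseteq> S"
      by (auto simp: left_ends_def)
    obtain e where e: "e \<in> components S" "{q<..<q + \<delta>} \<subseteq> e"
      using exists_component_superset[OF \<delta>(2)] meet[OF \<delta>(1) \<delta>(1)] \<delta>(2) by (metis Int_absorb connected_Ioo subset_empty)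
    have "q \<le> z" if "z \<in> e" for z
    proof (rule ccontr)
      assume "\<not> q \<le> z"
      have "q + \<delta> / 2 \<in> e"
        using e(2) \<delta>(1) by auto
      then have "{z..q + \<delta> / 2} \<subseteq> e"
        using connectedD_interval[OF in_components_connected[OF e(1)] that] by auto
      moreover have "{q - min (q - z) (\<delta> / 2)<..<q + min (q - z) (\<delta> / 2)} \<subseteq> {z..q + \<delta> / 2}"
        by auto
      ultimately have "{q - min (q - z) (\<delta> / 2)<..<q + min (q - z) (\<delta> / 2)} \<subseteq> S"
        using in_components_subset[OF e(1)] by blast
      moreover have "min (q - z) (\<delta> / 2) > 0"
        using \<open>\<not> q \<le> z\<close> \<delta>(1) by auto
      ultimately show False
        using q unfolding left_ends_def by blast
    qed
    moreover have "\<exists>z\<in>e. z < y" if "q < y" for y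
    proof -
      have "q + min (y - q) \<delta> / 2 \<in> {q<..<q + \<delta>}" "q + min (y - q) \<delta> / 2 < y"
        using that \<delta>(1) by (auto simp: min_def field_simps)
      then show ?thesis
        using e(2) by blast
    qed
    ultimately have "Inf e = q"
      using in_components_nonempty[OF e(1)] by (intro cInf_eq_non_empty) (auto, meson not_le)
    then show "q \<in> Inf ` components S"
      using e by blast
  qed
qed

text \<open>The component \<open>E\<close> containing the image of \<open>C\<close> pulls back to a
  connected set that meets \<open>C\<close>, which the maximality of \<open>C\<close> confines to
  \<open>C\<close>.\<close>

lemma homeomorphism_image_component:
  assumes "homeomorphism S R f g" "C \<in> components S"
  shows "f ` C \<in> components R"
proof -
  have C: "C \<subseteq> S" "connected C" "C \<noteq> {}"
    using assms(2) in_components_subset in_components_connected in_components_nonempty by blast+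
  have fg: "f ` S = R" "continuous_on S f" "g ` R = S" "continuous_on R g"
    "\<And>x. x \<in> S \<Longrightarrow> g (f x) = x" "\<And>y. y \<in> R \<Longrightarrow> f (g y) = y"
    using assms(1) by (auto simp: homeomorphism_def)
  have "connected (f ` C)" "f ` C \<subseteq> R"
    using C fg(1,2) by (auto intro: connected_continuous_image continuous_on_subset)
  then obtain E where E: "E \<in> components R" "f ` C \<subseteq> E"
    using exists_component_superset[of "f ` C" R] C by auto
  have ER: "E \<subseteq> R"
    using E in_components_subset by blast
  have "connected (g ` E)"
    using ER fg(4) in_components_connected[OF E(1)]
    by (auto intro: connected_continuous_image continuous_on_subset)
  moreover have "g ` E \<subseteq> S"
    using ER fg(3) by blast
  moreover have "C \<inter> g ` E \<noteq> {}"
    using C E fg(5) by force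
  ultimately have "g ` E \<subseteq> C"
    using components_maximal[OF assms(2)] by blast
  then have "E \<subseteq> f ` C"
    using fg(6) ER by force
  then show ?thesis
    using E by (simp add: subset_antisym)
qed

lemma bij_betw_components_homeomorphism:
  assumes "homeomorphism S R f g"
  shows "bij_betw ((`) f) (components S) (components R)"
proof (rule bij_betw_byWitness[where f' = "(`) g"])
  have fg: "\<And>x. x \<in> S \<Longrightarrow> g (f x) = x" "\<And>y. y \<in> R \<Longrightarrow> f (g y) = y"
    using assms by (auto simp: homeomorphism_def)
  show "\<forall>C\<in>components S. g ` f ` C = C"
    using fg(1) in_components_subset by (force simp: image_image)
  show "\<forall>C\<in>components R. f ` g ` C = C"
    using fg(2) in_components_subset by (force simp: image_image)
  show "(`) f ` components S \<subseteq> components R"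
    using homeomorphism_image_component[OF assms] by blast
  show "(`) g ` components R \<subseteq> components S"
    using homeomorphism_image_component[OF homeomorphism_symD[OF assms]] by blast
qed

section \<open>Locality of the graph and its components along a line\<close>

context tessellation
begin

text \<open>A segment whose closure enters the open set \<open>U\<close> enters \<open>U\<close>
  itself, and a single common point decides whether a segment-closed graph contains all of the
  segment or none of it.\<close>

lemma segment_local:
  assumes "segment_closed T D \<gamma>" "segment_closed T D \<gamma>'" "open U" "\<gamma> \<inter> U = \<gamma>' \<inter> U"
    and "s \<in> segments T D" "y \<in> closure s" "y \<in> U"
  shows "s \<subseteq> \<gamma> \<longleftrightarrow> s \<subseteq> \<gamma>'"
proof -
  obtain x where "x \<in> s" "x \<in> U"
    using assms(3,6,7) open_Int_closure_eq_empty by (metis IntE IntI empty_iff ex_in_conv)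
  then have "x \<in> \<gamma> \<longleftrightarrow> x \<in> \<gamma>'"
    using assms(4) by blast
  moreover have "s \<subseteq> \<gamma> \<longleftrightarrow> x \<in> \<gamma>" "s \<subseteq> \<gamma>' \<longleftrightarrow> x \<in> \<gamma>'"
    using assms(1,2,5) \<open>x \<in> s\<close> unfolding segment_closed_def by auto
  ultimately show ?thesis
    by blast
qed

lemma incident_local:
  assumes "segment_closed T D \<gamma>" "segment_closed T D \<gamma>'" "open U" "\<gamma> \<inter> U = \<gamma>' \<inter> U" "y \<in> U"
  shows "incident T D \<gamma> y = incident T D \<gamma>' y"
proof -
  have "s \<subseteq> \<gamma> \<longleftrightarrow> s \<subseteq> \<gamma>'" if "s \<in> segments T D" "y \<in> closure s" for s
    using segment_local[OF assms(1-4) that assms(5)] .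
  then show ?thesis
    unfolding incident_def graph_segments_def by blast
qed

lemma mem_graph_on_line_iff:
  "y \<in> graph_on_line T D \<gamma> l \<longleftrightarrow> y \<in> D \<and> (\<exists>s\<in>incident T D \<gamma> y. s \<subseteq> l)"
  by (auto simp: graph_on_line_def incident_def)

lemma segment_two_points:
  assumes "open D" "s \<in> segments T D"
  shows "\<exists>x\<in>s. \<exists>y\<in>s. x \<noteq> y"
proof -
  obtain l where l: "l \<in> T" "s \<in> components (l \<inter> D - nodes T)"
    using segmentE[OF assms(2)] by metis
  then obtain x where x: "x \<in> s"
    using in_components_nonempty by blast
  then have x': "x \<in> D" "x \<in> l" "x \<notin> nodes T"
    using l in_components_subset by blast+
  obtain s' \<delta> where s': "s' \<in> segments T D" "x \<in> s'" "\<delta> > 0" "l \<inter> ball x \<delta> \<subseteq> s'"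
    using segment_through[OF assms(1) x'(1,2) l(1) x'(3)] by metis
  have "s' = s"
    using segments_eq s' assms(2) x by blast
  obtain a v where v: "norm v = 1" and lv: "l = range (\<lambda>t. a + t *\<^sub>R v)"
    using line_param[OF l(1)] .
  obtain t where t: "x = a + t *\<^sub>R v"
    using x'(2) lv by blast
  let ?y = "a + (t + \<delta> / 2) *\<^sub>R v"
  have "?y = x + (\<delta> / 2) *\<^sub>R v"
    by (simp add: t algebra_simps)
  then have "dist x ?y = \<delta> / 2"
    using v s'(3) by (simp add: dist_norm)
  then have "?y \<in> l \<inter> ball x \<delta>" "?y \<noteq> x"
    using lv s'(3) by auto
  then show ?thesis
    using x s'(4) \<open>s' = s\<close> by blast
qed

lemma segment_subset_graph_on_line:
  assumes "segment_closed T D \<gamma>" "s \<in> segments T D" "s \<subseteq> \<gamma>" "s \<subseteq> l" "P \<subseteq> nodes T"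
  shows "s \<subseteq> graph_on_line T D \<gamma> l - P"
proof -
  have "s \<in> {s \<in> graph_segments T D \<gamma>. s \<subseteq> l}"
    using assms by (simp add: graph_segments_def)
  then have "D \<inter> closure s \<subseteq> graph_on_line T D \<gamma> l"
    unfolding graph_on_line_def by blast
  then show ?thesis
    using assms(5) segment_disjoint_nodes[OF assms(2)] closure_subset[of s] by auto
qed

text \<open>This provides the nondegeneracy for counting by left ends. A point of the graph on
  \<open>l\<close> lies in the closure of a graph segment; the segment together with that point is
  connected, and removing the set \<open>P\<close> of nodes does not touch the segment.\<close>

lemma component_two_points:
  assumes "open D" "segment_closed T D \<gamma>" "P \<subseteq> nodes T" "e \<in> components (graph_on_line T D \<gamma> l - P)"
  shows "\<exists>x\<in>e. \<exists>y\<in>e. x \<noteq> y"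
proof -
  obtain x where x: "x \<in> e"
    using assms(4) in_components_nonempty by blast
  then have xS: "x \<in> graph_on_line T D \<gamma> l - P"
    using assms(4) in_components_subset by blast
  then obtain s where s: "s \<in> segments T D" "s \<subseteq> \<gamma>" "s \<subseteq> l" "x \<in> closure s"
    by (auto simp: graph_on_line_def graph_segments_def)
  have "connected s"
    using segmentE[OF s(1)] in_components_connected by metis
  then have "connected (insert x s)"
    by (rule connected_intermediate_closure) (use s(4) closure_subset[of s] in blast)+
  moreover have "insert x s \<subseteq> graph_on_line T D \<gamma> l - P"
    using segment_subset_graph_on_line[OF assms(2) s(1-3) assms(3)] xS by blast
  moreover have "e \<inter> insert x s \<noteq> {}"
    using x by blast
  ultimately have "insert x s \<subseteq> e"
    by (rule components_maximal[OF assms(4)])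
  then show ?thesis
    using segment_two_points[OF assms(1) s(1)] by blast
qed

lemma graph_on_line_subset: "l \<in> T \<Longrightarrow> graph_on_line T D \<gamma> l \<subseteq> l \<inter> D"
proof -
  assume l: "l \<in> T"
  have "closure s \<subseteq> l" if "s \<subseteq> l" for s
    using that line_closed[OF l] by (rule closure_minimal)
  then show ?thesis
    unfolding graph_on_line_def by blast
qed

text \<open>Confining the left ends to nodes and frontier points gives a set of candidates that does
  not depend on the graph. The claim on finiteness is separate because \<open>card\<close> is 0 on
  infinite sets.\<close>

lemma card_components_line:
  fixes a v :: point
  defines "p \<equiv> \<lambda>t. a + t *\<^sub>R v"
  assumes "open D" "bounded D" "l \<in> T" "norm v = 1" "l = range p" "segment_closed T D \<gamma>" "P \<subseteq> nodes T"
    and S: "S = graph_on_line T D \<gamma> l - P"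
  shows "card (components S) = card (left_ends (p -` S))"
    and "left_ends (p -` S) \<subseteq> p -` ((nodes T \<inter> D) \<union> (l \<inter> frontier D))"
    and "finite (left_ends (p -` S)) \<longleftrightarrow> finite (components S)"
proof -
  have Sl: "S \<subseteq> l" "S \<subseteq> D"
    using graph_on_line_subset[OF assms(4)] S by blast+
  have vv: "v \<bullet> v = 1"
    using assms(5) by (simp add: norm_eq_1)
  have "homeomorphism (p -` S) S p (\<lambda>y. (y - a) \<bullet> v)"
  proof
    show "continuous_on (p -` S) p" "continuous_on S (\<lambda>y. (y - a) \<bullet> v)"
      unfolding p_def by (intro continuous_intros)+
  qed (use Sl assms(6) vv in \<open>auto simp: p_def\<close>)
  then have bij1: "bij_betw ((`) p) (components (p -` S)) (components S)"
    by (rule bij_betw_components_homeomorphism)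
  have bij2: "bij_betw Inf (components (p -` S)) (left_ends (p -` S))"
  proof (rule bij_betw_Inf_components)
    obtain B where B: "\<And>x. x \<in> D \<Longrightarrow> norm x \<le> B"
      using assms(3) by (auto simp: bounded_iff)
    have "- (B + norm a) \<le> t" if "p t \<in> S" for t
    proof -
      have "norm (t *\<^sub>R v) \<le> norm (p t) + norm a"
        using norm_triangle_ineq4[of "p t" a] by (simp add: p_def)
      then have "\<bar>t\<bar> \<le> B + norm a"
        using assms(5) B[of "p t"] that Sl(2) by fastforce
      then show ?thesis by linarith
    qed
    then show "bdd_below (p -` S)"
      by (auto intro!: bdd_belowI)
    fix e assume e: "e \<in> components (p -` S)"
    then have "p ` e \<in> components S"
      using bij1 by (auto simp: bij_betw_def)
    then obtain x y where "x \<in> p ` e" "y \<in> p ` e" "x \<noteq> y"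
      using component_two_points[OF assms(2,7,8)] S by blast
    then obtain t u where "t \<in> e" "u \<in> e" "t \<noteq> u"
      by blast
    then show "\<exists>x\<in>e. \<exists>y\<in>e. x < y"
      by (metis neq_iff)
  qed
  show "card (components S) = card (left_ends (p -` S))"
    using bij_betw_same_card[OF bij1] bij_betw_same_card[OF bij2] by simp
  show "finite (left_ends (p -` S)) \<longleftrightarrow> finite (components S)"
    using bij_betw_finite[OF bij1] bij_betw_finite[OF bij2] by simp
  have dist_p: "dist (p t) (p u) = \<bar>t - u\<bar>" for t u
    using assms(5) by (simp add: p_def dist_norm flip: scaleR_left_diff_distrib)
  show "left_ends (p -` S) \<subseteq> p -` ((nodes T \<inter> D) \<union> (l \<inter> frontier D))"
  proof
    fix t assume t: "t \<in> left_ends (p -` S)"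
    then obtain \<delta> where \<delta>: "\<delta> > 0" "{t<..<t + \<delta>} \<subseteq> p -` S"
      by (auto simp: left_ends_def)
    have near: "\<exists>u\<in>{t<..<t + \<delta>}. \<bar>t - u\<bar> < \<epsilon>" if "\<epsilon> > 0" for \<epsilon>
      using that \<delta>(1) by (intro bexI[of _ "t + min \<delta> \<epsilon> / 2"]) (auto simp: min_def)
    have "p t \<in> closure D"
      unfolding closure_approachable
    proof (intro allI impI)
      fix \<epsilon> :: real assume "\<epsilon> > 0"
      then obtain u where "u \<in> {t<..<t + \<delta>}" "\<bar>t - u\<bar> < \<epsilon>"
        using near by blast
      then show "\<exists>y\<in>D. dist y (p t) < \<epsilon>"
        using \<delta>(2) Sl(2) dist_p[of t u] by (intro bexI[of _ "p u"]) (auto simp: dist_commute)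
    qed
    moreover have "p t \<in> nodes T" if ptD: "p t \<in> D"
    proof (rule ccontr)
      \<comment> \<open>Points of \<open>S\<close> lie just to the right of \<open>p t\<close>, on
        the segment through \<open>p t\<close>. A segment-closed graph then contains this whole
        segment, so \<open>S\<close> continues to the left of \<open>p t\<close>.\<close>
      assume nn: "p t \<notin> nodes T"
      have ptl: "p t \<in> l"
        using assms(6) by blast
      obtain s \<delta>' where s: "s \<in> segments T D" "p t \<in> s" "s \<subseteq> l" "\<delta>' > 0" "l \<inter> ball (p t) \<delta>' \<subseteq> s"
        using segment_through[OF assms(2) ptD ptl assms(4) nn] by metis
      obtain u where u: "u \<in> {t<..<t + \<delta>}" "\<bar>t - u\<bar> < \<delta>'"
        using near[OF s(4)] by blast
      then have "p u \<in> s"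
        using s(5) assms(6) dist_p[of t u] by auto
      moreover have "p u \<in> S"
        using u \<delta>(2) by blast
      then obtain s' where s': "s' \<in> segments T D" "s' \<subseteq> \<gamma>" "p u \<in> closure s'" "p u \<in> D"
        by (auto simp: S graph_on_line_def graph_segments_def)
      have "p u \<in> s'"
        using closure_segment_nonnode[OF s'(1,3,4)] assms(4,6) segment_disjoint_nodes[OF s(1)] \<open>p u \<in> s\<close> by blast
      ultimately have "s = s'"
        using segments_eq s(1) s'(1) by blast
      then have "s \<subseteq> S"
        using segment_subset_graph_on_line[OF assms(7) s(1) _ s(3) assms(8)] s'(2) S by blast
      moreover have "{t - \<delta>'<..<t + \<delta>'} \<subseteq> p -` s"
        using s(5) assms(6) dist_p by fastforce
      ultimately have "{t - \<delta>'<..<t + \<delta>'} \<subseteq> p -` S"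
        by blast
      then show False
        using t s(4) by (auto simp: left_ends_def)
    qed
    ultimately show "t \<in> p -` ((nodes T \<inter> D) \<union> (l \<inter> frontier D))"
      using assms(2,6) by (auto simp: frontier_def interior_open)
  qed
qed

end

text \<open>None of the terms is \<open>- \<infinity>\<close>, so the extended sum is unambiguous.
  The convention that 0 times an infinite value is 0 becomes \<open>x ^ 0 = 1\<close> even for
  \<open>x = 0\<close>, and the value 0 given to infinite energy becomes \<open>0 ^ n = 0\<close>
  for positive \<open>n\<close>.\<close>

lemma elog_weight:
  fixes a b c r :: real and i j m :: nat
  assumes "a \<ge> 0" "b \<ge> 0" "c \<ge> 0"
    and \<Phi>: "\<Phi> = - (ereal (real i) * elog a) - ereal (real j) * elog b - ereal (real m) * elog c + ereal r"
  shows "(if \<Phi> = \<infinity> then 0 else exp (- real_of_ereal \<Phi>)) = a ^ i * b ^ j * c ^ m * exp (- r)"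
proof -
  have *: "(\<exists>y. ereal (real n) * elog x = ereal y \<and> exp y = x ^ n) \<or> ereal (real n) * elog x = - \<infinity> \<and> x ^ n = 0"
    if "x \<ge> 0" for x :: real and n :: nat
    using that by (cases "n = 0") (auto simp: elog_def exp_of_nat_mult)
  show ?thesis
    using *[OF assms(1), of i] *[OF assms(2), of j] *[OF assms(3), of m] unfolding \<Phi>
    by (elim disjE exE conjE) (auto simp: exp_add exp_diff exp_minus field_simps)
qed

section \<open>The terms of the energy as finite sums over nodes and lines\<close>

locale bounded_region = tessellation T for T +
  fixes D :: "point set"
  assumes open_D: "open D" and bounded_D: "bounded D"
    and finite_frontier: "\<And>l. l \<in> T \<Longrightarrow> finite (l \<inter> frontier D)"
begin

definition "lines_D = {l \<in> T. l \<inter> D \<noteq> {}}"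

lemma finite_lines_D: "finite lines_D"
  unfolding lines_D_def by (rule finite_lines_hitting[OF bounded_D])

lemma finite_nodes_D: "finite (nodes T \<inter> D)"
  by (rule finite_nodes[OF bounded_D])

text \<open>The index set no longer depends on the graph, so that two graphs can be compared term by
  term.\<close>

lemma num_vertices_sum:
  "num_vertices T D \<gamma> d = (\<Sum>n\<in>nodes T \<inter> D. of_bool (n \<in> vertices T D \<gamma> \<and> card (incident T D \<gamma> n) = d))"
proof -
  have "{n \<in> vertices T D \<gamma>. card (incident T D \<gamma> n) = d} =
      {n \<in> nodes T \<inter> D. n \<in> vertices T D \<gamma> \<and> card (incident T D \<gamma> n) = d}"
    by (auto simp: vertices_def)
  then show ?thesis
    using finite_nodes_D by (simp add: num_vertices_def of_bool_def flip: sum.inter_filter)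
qed

lemma graph_on_line_off_D: "l \<in> T \<Longrightarrow> l \<notin> lines_D \<Longrightarrow> graph_on_line T D \<gamma> l = {}"
  using graph_on_line_subset[of l D \<gamma>] by (auto simp: lines_D_def)

lemma finite_components_line:
  assumes "l \<in> T" "segment_closed T D \<gamma>" "P \<subseteq> nodes T"
  shows "finite (components (graph_on_line T D \<gamma> l - P))"
proof -
  obtain a v where v: "norm v = 1" "l = range (\<lambda>t. a + t *\<^sub>R v)"
    using line_param[OF assms(1)] .
  note card = card_components_line[OF open_D bounded_D assms(1) v assms(2,3) refl]
  have "inj (\<lambda>t. a + t *\<^sub>R v)"
    using v(1) by (intro injI) auto
  then have "finite ((\<lambda>t. a + t *\<^sub>R v) -` ((nodes T \<inter> D) \<union> (l \<inter> frontier D)))"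
    using finite_nodes_D finite_frontier[OF assms(1)] by (intro finite_vimageI) auto
  then show ?thesis
    using card(2,3) finite_subset by blast
qed

text \<open>A component has two points, and two lines share at most one. Hence edges are sorted
  disjointly by lines, and \<open>line_of\<close> picks the expected line.\<close>

lemma component_line_unique:
  assumes "l \<in> T" "l' \<in> T" "segment_closed T D \<gamma>" "P \<subseteq> nodes T"
    and "e \<in> components (graph_on_line T D \<gamma> l - P)" "e \<subseteq> l'"
  shows "l' = l"
proof -
  have "e \<subseteq> l"
    using in_components_subset[OF assms(5)] graph_on_line_subset[OF assms(1)] by blast
  moreover obtain x y where "x \<in> e" "y \<in> e" "x \<noteq> y"
    using component_two_points[OF open_D assms(3-5)] by blast
  ultimately show ?thesis
    using lines_meet_once[OF assms(2,1)] assms(6) by blast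
qed

lemma component_subset_line:
  "\<lbrakk>l \<in> T; e \<in> components (graph_on_line T D \<gamma> l - P)\<rbrakk> \<Longrightarrow> e \<subseteq> l"
  using in_components_subset[of e] graph_on_line_subset[of l D \<gamma>] by blast

lemma components_disjoint_lines:
  assumes "l \<in> T" "l' \<in> T" "l \<noteq> l'" "segment_closed T D \<gamma>" "P \<subseteq> nodes T"
  shows "components (graph_on_line T D \<gamma> l - P) \<inter> components (graph_on_line T D \<gamma> l' - P) = {}"
  using component_line_unique[OF assms(1,2,4,5)] component_subset_line[OF assms(2)] assms(3) by blast

lemma vertices_subset_nodes: "vertices T D \<gamma> \<subseteq> nodes T"
  by (auto simp: vertices_def)

lemma union_components_lines_D:
  "(\<Union>l\<in>T. components (graph_on_line T D \<gamma> l - P)) = (\<Union>l\<in>lines_D. components (graph_on_line T D \<gamma> l - P))"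
proof -
  have "components (graph_on_line T D \<gamma> l - P) = {}" if "l \<in> T" "l \<notin> lines_D" for l
    using graph_on_line_off_D[OF that] by simp
  moreover have "lines_D \<subseteq> T"
    by (auto simp: lines_D_def)
  ultimately show ?thesis
    by blast
qed

lemma finite_edges:
  assumes "segment_closed T D \<gamma>" shows "finite (edges T D \<gamma>)"
  unfolding edges_def union_components_lines_D
  using finite_lines_D finite_components_line[OF _ assms vertices_subset_nodes]
  by (auto simp: lines_D_def)

lemma card_edges:
  assumes "segment_closed T D \<gamma>"
  shows "card (edges T D \<gamma>) = (\<Sum>l\<in>lines_D. card (components (graph_on_line T D \<gamma> l - vertices T D \<gamma>)))"
  unfolding edges_def union_components_lines_D
proof (rule card_UN_disjoint[OF finite_lines_D])
  show "\<forall>l\<in>lines_D. finite (components (graph_on_line T D \<gamma> l - vertices T D \<gamma>))"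
    using finite_components_line[OF _ assms vertices_subset_nodes] by (auto simp: lines_D_def)
  show "\<forall>l\<in>lines_D. \<forall>l'\<in>lines_D. l \<noteq> l' \<longrightarrow>
      components (graph_on_line T D \<gamma> l - vertices T D \<gamma>) \<inter> components (graph_on_line T D \<gamma> l' - vertices T D \<gamma>) = {}"
    using components_disjoint_lines[OF _ _ _ assms vertices_subset_nodes] by (auto simp: lines_D_def)
qed

lemma prod_primary_edges:
  fixes act :: "point set \<Rightarrow> real"
  assumes "segment_closed T D \<gamma>"
  shows "(\<Prod>e\<in>primary_edges T D \<gamma>. act (line_of T e)) =
    (\<Prod>l\<in>lines_D. act l ^ card (components (graph_on_line T D \<gamma> l)))"
proof -
  have line: "line_of T e = l" if "l \<in> lines_D" "e \<in> components (graph_on_line T D \<gamma> l)" for e l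
    unfolding line_of_def
    using that component_line_unique[OF _ _ assms empty_subsetI] component_subset_line[of l e \<gamma> "{}"]
    by (intro the_equality) (auto simp: lines_D_def)
  have "(\<Prod>e\<in>primary_edges T D \<gamma>. act (line_of T e)) =
      (\<Prod>l\<in>lines_D. \<Prod>e\<in>components (graph_on_line T D \<gamma> l). act (line_of T e))"
    unfolding primary_edges_def using union_components_lines_D[of \<gamma> "{}"]
    using components_disjoint_lines[OF _ _ _ assms empty_subsetI] finite_components_line[OF _ assms empty_subsetI]
    by (simp, intro prod.UNION_disjoint finite_lines_D) (auto simp: lines_D_def)
  also have "\<dots> = (\<Prod>l\<in>lines_D. \<Prod>e\<in>components (graph_on_line T D \<gamma> l). act l)"
    using line by (intro prod.cong) auto
  finally show ?thesis
    by simp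
qed

text \<open>A line crossing an edge meets it in exactly one node. Conversely the node and the
  crossing line determine the edge: only one other line passes through the node, and only one
  component on that line contains it. So the double sum runs over pairs of a node and a line.
  Excluding vertices on the right reflects that edges are open.\<close>

lemma sum_crossings:
  fixes F :: "point set \<Rightarrow> real"
  assumes "segment_closed T D \<gamma>"
  shows "(\<Sum>e\<in>edges T D \<gamma>. \<Sum>l\<in>{l \<in> T. crosses l e}. F l) =
    (\<Sum>n\<in>nodes T \<inter> D. \<Sum>l\<in>{l \<in> T. n \<in> l \<and> (\<exists>l0\<in>T. l0 \<noteq> l \<and> n \<in> graph_on_line T D \<gamma> l0 - vertices T D \<gamma>)}. F l)"
    (is "?lhs = (\<Sum>n\<in>_. sum F (?B n))")
proof -
  let ?S = "\<lambda>l. graph_on_line T D \<gamma> l - vertices T D \<gamma>"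
  have edgeE: "\<exists>l0\<in>T. e \<in> components (?S l0) \<and> e \<subseteq> ?S l0 \<and> e \<subseteq> l0 \<inter> D" if e: "e \<in> edges T D \<gamma>" for e
  proof -
    obtain l0 where l0: "l0 \<in> T" "e \<in> components (?S l0)"
      using e unfolding edges_def by blast
    then show ?thesis
      using in_components_subset[OF l0(2)] graph_on_line_subset[OF l0(1)] by blast
  qed
  have fin1: "finite {l \<in> T. crosses l e}" if "e \<in> edges T D \<gamma>" for e
    by (rule finite_subset[OF _ finite_lines_D]) (use edgeE[OF that] in \<open>auto simp: crosses_def lines_D_def\<close>)
  have fin2: "finite (?B n)" if "n \<in> nodes T \<inter> D" for n
    by (rule finite_subset[OF _ finite_lines_D]) (use that in \<open>auto simp: lines_D_def\<close>)
  define A where "A = (SIGMA e:edges T D \<gamma>. {l \<in> T. crosses l e})"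
  define B where "B = (SIGMA n:nodes T \<inter> D. ?B n)"
  \<comment> \<open>The choice is harmless: the edge lies on a different line, so the intersection
    has exactly one point.\<close>
  define h where "h = (\<lambda>(e, l). (SOME n. n \<in> l \<inter> e, l :: point set))"
  have h: "\<exists>n. h (e, l) = (n, l) \<and> n \<in> l \<inter> e" if "(e, l) \<in> A" for e l
  proof -
    have "l \<inter> e \<noteq> {}"
      using that by (auto simp: A_def crosses_def)
    then have "(SOME n. n \<in> l \<inter> e) \<in> l \<inter> e"
      unfolding some_in_eq .
    then show ?thesis
      by (simp add: h_def)
  qed
  have "bij_betw h A B"
    unfolding bij_betw_def
  proof (intro conjI equalityI subsetI)
    show "inj_on h A"
    proof (rule inj_onI, clarify)
      fix e l e' l' assume A: "(e, l) \<in> A" "(e', l') \<in> A" "h (e, l) = h (e', l')"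
      then obtain n where n: "l' = l" "n \<in> l \<inter> e" "n \<in> l \<inter> e'"
        using h by (metis Pair_inject)
      have e: "e \<in> edges T D \<gamma>" "e' \<in> edges T D \<gamma>" "l \<in> T" "\<not> e \<subseteq> l" "\<not> e' \<subseteq> l"
        using A n(1) by (auto simp: A_def crosses_def)
      obtain l1 l2 where l1: "l1 \<in> T" "e \<in> components (?S l1)" "e \<subseteq> l1 \<inter> D"
        and l2: "l2 \<in> T" "e' \<in> components (?S l2)" "e' \<subseteq> l2 \<inter> D"
        using edgeE e(1,2) by metis
      have "l \<noteq> l1" "l \<noteq> l2"
        using l1 l2 e by auto
      \<comment> \<open>Three distinct lines would otherwise pass through \<open>n\<close>.\<close>
      then have "l1 = l2"
        using no_three_concurrent[OF e(3) l1(1) l2(1), of n] n l1 l2 by blast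
      then have "e = e'"
        using components_eq[of e _ e'] l1 l2 n by blast
      then show "e = e' \<and> l = l'"
        using n by simp
    qed
  next
    fix z assume "z \<in> h ` A"
    then obtain e l where el: "(e, l) \<in> A" "z = h (e, l)"
      by auto
    obtain n where n: "z = (n, l)" "n \<in> l \<inter> e"
      using h[OF el(1)] el(2) by auto
    have e: "e \<in> edges T D \<gamma>" "l \<in> T" "\<not> e \<subseteq> l"
      using el(1) by (auto simp: A_def crosses_def)
    obtain l0 where l0: "l0 \<in> T" "e \<subseteq> ?S l0" "e \<subseteq> l0 \<inter> D"
      using edgeE[OF e(1)] by blast
    have "l0 \<noteq> l"
      using l0 e by auto
    then have "n \<in> nodes T" "n \<in> D" "l \<in> ?B n"
      using l0 n e by (auto simp: nodes_def)
    then show "z \<in> B"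
      using n by (simp add: B_def)
  next
    fix z assume "z \<in> B"
    then obtain n l l0 where z: "z = (n, l)" "n \<in> nodes T \<inter> D" "l \<in> T" "n \<in> l" "l0 \<in> T" "l0 \<noteq> l" "n \<in> ?S l0"
      by (auto simp: B_def)
    obtain e where e: "e \<in> components (?S l0)" "n \<in> e"
      using z(7) Union_components[of "?S l0"] by blast
    have "\<not> e \<subseteq> l"
      using component_line_unique[OF z(5,3) assms vertices_subset_nodes e(1)] z(6) by blast
    then have eA: "(e, l) \<in> A"
      using e z by (auto simp: A_def crosses_def edges_def)
    then obtain n' where n': "h (e, l) = (n', l)" "n' \<in> l \<inter> e"
      using h by blast
    have "n' = n"
      using lines_meet_once[OF z(3,5), of n' n] n'(2) z e(2) component_subset_line[OF z(5) e(1)] by blast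
    then show "z \<in> h ` A"
      using n'(1) z(1) eA by (metis image_eqI)
  qed
  moreover have "snd (h z) = snd z" for z
    by (simp add: h_def split: prod.split)
  ultimately have "(\<Sum>z\<in>A. F (snd z)) = (\<Sum>z\<in>B. F (snd z))"
    using sum.reindex_bij_betw[of h A B "\<lambda>z. F (snd z)"] by simp
  then show ?thesis
    unfolding A_def B_def
    using sum.Sigma[of "edges T D \<gamma>" "\<lambda>e. {l \<in> T. crosses l e}" "\<lambda>e l. F l"] finite_edges[OF assms] fin1
      sum.Sigma[of "nodes T \<inter> D" ?B "\<lambda>n l. F l"] finite_nodes_D fin2
    by (simp add: split_def)
qed

end

section \<open>Exchange identities for sums of germ-dependent terms\<close>

definition germ_local :: "point set set \<Rightarrow> point set \<Rightarrow> point \<Rightarrow> (point set \<Rightarrow> 'b) \<Rightarrow> bool" where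
  "germ_local T D q \<phi> \<longleftrightarrow> (\<forall>\<gamma> \<gamma>' U. segment_closed T D \<gamma> \<and> segment_closed T D \<gamma>' \<and> open U \<and> q \<in> U \<and>
     \<gamma> \<inter> U = \<gamma>' \<inter> U \<longrightarrow> \<phi> \<gamma> = \<phi> \<gamma>')"

text \<open>In the application \<open>U1\<close> and \<open>U2\<close> are the inside and the outside of the curve, and
  \<open>\<gamma>3\<close>, \<open>\<gamma>4\<close> arise from \<open>\<gamma>1\<close>, \<open>\<gamma>2\<close> by exchanging the inner parts. On the
  curve itself the four germs may differ, but no germ there contributes to the energy.\<close>

locale exchange = bounded_region T D for T D +
  fixes U1 U2 \<gamma>1 \<gamma>2 \<gamma>3 \<gamma>4 :: "point set"
  assumes closed: "segment_closed T D \<gamma>1" "segment_closed T D \<gamma>2" "segment_closed T D \<gamma>3" "segment_closed T D \<gamma>4"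
    and open_U: "open U1" "open U2"
    and eq_U1: "\<gamma>3 \<inter> U1 = \<gamma>1 \<inter> U1" "\<gamma>4 \<inter> U1 = \<gamma>2 \<inter> U1"
    and eq_U2: "\<gamma>3 \<inter> U2 = \<gamma>2 \<inter> U2" "\<gamma>4 \<inter> U2 = \<gamma>1 \<inter> U2"
    and nodes_U: "nodes T \<inter> D \<subseteq> U1 \<union> U2" and frontier_U: "frontier D \<subseteq> U1 \<union> U2"
begin

text \<open>At a point of \<open>U1\<close> the germs of \<open>\<gamma>3\<close>,
  \<open>\<gamma>4\<close> are those of \<open>\<gamma>1\<close>, \<open>\<gamma>2\<close>; at a
  point of \<open>U2\<close> they are the same in the other order. So each term is exchanged
  separately. The map \<open>pt\<close> is there because left ends are indexed by parameters on a
  line, and the general monoid serves both counts and real sums.\<close>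

lemma germ_sum:
  fixes \<phi> :: "_ \<Rightarrow> _ \<Rightarrow> 'b :: comm_monoid_add"
  assumes "\<And>q. q \<in> Q \<Longrightarrow> pt q \<in> U1 \<union> U2" "\<And>q. q \<in> Q \<Longrightarrow> germ_local T D (pt q) (\<phi> q)"
  shows "(\<Sum>q\<in>Q. \<phi> q \<gamma>1) + (\<Sum>q\<in>Q. \<phi> q \<gamma>2) = (\<Sum>q\<in>Q. \<phi> q \<gamma>3) + (\<Sum>q\<in>Q. \<phi> q \<gamma>4)"
proof -
  have "\<phi> q \<gamma>1 + \<phi> q \<gamma>2 = \<phi> q \<gamma>3 + \<phi> q \<gamma>4" if q: "q \<in> Q" for q
  proof (cases "pt q \<in> U1")
    case True
    then have "\<phi> q \<gamma>3 = \<phi> q \<gamma>1" "\<phi> q \<gamma>4 = \<phi> q \<gamma>2"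
      using assms(2)[OF q] closed open_U eq_U1 unfolding germ_local_def by blast+
    then show ?thesis by simp
  next
    case False
    then have "pt q \<in> U2"
      using assms(1)[OF q] by blast
    then have "\<phi> q \<gamma>3 = \<phi> q \<gamma>2" "\<phi> q \<gamma>4 = \<phi> q \<gamma>1"
      using assms(2)[OF q] closed open_U eq_U2 unfolding germ_local_def by blast+
    then show ?thesis by (simp add: add.commute)
  qed
  then show ?thesis
    by (simp flip: sum.distrib cong: sum.cong)
qed

text \<open>Vertex counts and crossings see the graph at a node only through the incident segments,
  so both are instances of this.\<close>

lemma exchange_nodes:
  fixes \<phi> :: "point \<Rightarrow> point set set \<Rightarrow> 'b :: comm_monoid_add"
  shows "(\<Sum>n\<in>nodes T \<inter> D. \<phi> n (incident T D \<gamma>1 n)) + (\<Sum>n\<in>nodes T \<inter> D. \<phi> n (incident T D \<gamma>2 n)) =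
    (\<Sum>n\<in>nodes T \<inter> D. \<phi> n (incident T D \<gamma>3 n)) + (\<Sum>n\<in>nodes T \<inter> D. \<phi> n (incident T D \<gamma>4 n))"
proof (rule germ_sum[where pt = "\<lambda>n. n" and \<phi> = "\<lambda>n \<gamma>. \<phi> n (incident T D \<gamma> n)"])
  show "germ_local T D n (\<lambda>\<gamma>. \<phi> n (incident T D \<gamma> n))" for n
    unfolding germ_local_def using incident_local by metis
qed (use nodes_U in blast)

lemma exchange_num_vertices:
  "num_vertices T D \<gamma>1 d + num_vertices T D \<gamma>2 d = num_vertices T D \<gamma>3 d + num_vertices T D \<gamma>4 d"
  unfolding num_vertices_sum vertices_def mem_Collect_eq
  using exchange_nodes[of "\<lambda>n I. of_bool ((n \<in> nodes T \<inter> D \<and> \<not> (\<exists>l\<in>T. \<forall>s\<in>I. s \<subseteq> l)) \<and> card I = d)"] .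

lemma exchange_crossings:
  fixes F :: "point set \<Rightarrow> real"
  defines "R \<equiv> \<lambda>\<gamma>. \<Sum>e\<in>edges T D \<gamma>. \<Sum>l\<in>{l \<in> T. crosses l e}. F l"
  shows "R \<gamma>1 + R \<gamma>2 = R \<gamma>3 + R \<gamma>4"
  unfolding R_def sum_crossings[OF closed(1)] sum_crossings[OF closed(2)]
    sum_crossings[OF closed(3)] sum_crossings[OF closed(4)] mem_graph_on_line_iff vertices_def Diff_iff mem_Collect_eq
  \<comment> \<open>The function repeats the unfolded inner sum literally, with \<open>I\<close> in
    place of the incident segments.\<close>
  using exchange_nodes[of "\<lambda>n I. \<Sum>l\<in>{l \<in> T. n \<in> l \<and> (\<exists>l0\<in>T. l0 \<noteq> l \<and> (n \<in> D \<and> (\<exists>s\<in>I. s \<subseteq> l0)) \<and>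
      \<not> (n \<in> nodes T \<inter> D \<and> \<not> (\<exists>l\<in>T. \<forall>s\<in>I. s \<subseteq> l)))}. F l"] .

lemma exchange_node_sum:
  fixes g :: "point \<Rightarrow> real"
  shows "sum g (nodes T \<inter> \<gamma>1) + sum g (nodes T \<inter> \<gamma>2) = sum g (nodes T \<inter> \<gamma>3) + sum g (nodes T \<inter> \<gamma>4)"
proof -
  have eq: "sum g (nodes T \<inter> \<gamma>) = (\<Sum>n\<in>nodes T \<inter> D. if n \<in> \<gamma> then g n else 0)" if "segment_closed T D \<gamma>" for \<gamma>
  proof -
    have "\<gamma> \<subseteq> D"
      using that by (simp add: segment_closed_def)
    then have "nodes T \<inter> \<gamma> = {n \<in> nodes T \<inter> D. n \<in> \<gamma>}"
      by blast
    then show ?thesis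
      by (simp only: sum.inter_filter[OF finite_nodes_D])
  qed
  have "germ_local T D n (\<lambda>\<gamma>. if n \<in> \<gamma> then g n else 0)" for n
    unfolding germ_local_def by (metis IntE IntI)
  then show ?thesis
    unfolding eq[OF closed(1)] eq[OF closed(2)] eq[OF closed(3)] eq[OF closed(4)]
    using nodes_U by (intro germ_sum[where pt = "\<lambda>n. n" and \<phi> = "\<lambda>n \<gamma>. if n \<in> \<gamma> then g n else 0"]) auto
qed

text \<open>\<open>P\<close> is the set of points at which a line is cut: the vertices for edges,
  nothing for primary edges. The possible left ends lie in a finite set independent of the graph,
  and whether a parameter is a left end depends on the germ there.\<close>

lemma exchange_components:
  assumes "l \<in> T" and P: "\<And>\<gamma>. P \<gamma> \<subseteq> nodes T" "\<And>n. germ_local T D n (\<lambda>\<gamma>. n \<in> P \<gamma>)"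
  defines "c \<equiv> \<lambda>\<gamma>. card (components (graph_on_line T D \<gamma> l - P \<gamma>))"
  shows "c \<gamma>1 + c \<gamma>2 = c \<gamma>3 + c \<gamma>4"
proof -
  obtain a v where v: "norm v = 1" "l = range (\<lambda>t. a + t *\<^sub>R v)"
    using line_param[OF assms(1)] .
  define p where "p = (\<lambda>t. a + t *\<^sub>R v)"
  define S where "S = (\<lambda>\<gamma>. graph_on_line T D \<gamma> l - P \<gamma>)"
  define Q where "Q = p -` ((nodes T \<inter> D) \<union> (l \<inter> frontier D))"
  have "inj p"
    unfolding p_def using v(1) by (intro injI) auto
  then have finQ: "finite Q"
    using finite_nodes_D finite_frontier[OF assms(1)] unfolding Q_def by (intro finite_vimageI) auto
  have c: "c \<gamma> = (\<Sum>t\<in>Q. of_bool (t \<in> left_ends (p -` S \<gamma>)))" if "segment_closed T D \<gamma>" for \<gamma>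
  proof -
    note card = card_components_line[OF open_D bounded_D assms(1) v that P(1)[of \<gamma>] refl]
    have "left_ends (p -` S \<gamma>) \<subseteq> Q"
      using card(2) unfolding p_def S_def Q_def .
    then have "left_ends (p -` S \<gamma>) = {t \<in> Q. t \<in> left_ends (p -` S \<gamma>)}"
      by blast
    then have "card (left_ends (p -` S \<gamma>)) = (\<Sum>t\<in>Q. of_bool (t \<in> left_ends (p -` S \<gamma>)))"
      using finQ by (simp add: of_bool_def flip: sum.inter_filter)
    then show ?thesis
      using card(1) unfolding c_def S_def p_def by simp
  qed
  have "germ_local T D (p t) (\<lambda>\<gamma>. of_bool (t \<in> left_ends (p -` S \<gamma>)) :: nat)" for t
    unfolding germ_local_def
  proof (intro allI impI, elim conjE)
    fix \<gamma> \<gamma>' U assume *: "segment_closed T D \<gamma>" "segment_closed T D \<gamma>'" "open U" "p t \<in> U" "\<gamma> \<inter> U = \<gamma>' \<inter> U"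
    have "y \<in> S \<gamma> \<longleftrightarrow> y \<in> S \<gamma>'" if "y \<in> U" for y
    proof -
      have "y \<in> P \<gamma> \<longleftrightarrow> y \<in> P \<gamma>'"
        using P(2)[of y] *(1-3,5) that unfolding germ_local_def by blast
      then show ?thesis
        using incident_local[OF *(1-3,5) that] by (simp add: S_def mem_graph_on_line_iff)
    qed
    then have "(p -` S \<gamma>) \<inter> (p -` U) = (p -` S \<gamma>') \<inter> (p -` U)"
      by auto
    moreover have "open (p -` U)"
      unfolding p_def using *(3) by (intro open_vimage continuous_intros)
    ultimately have "t \<in> left_ends (p -` S \<gamma>) \<longleftrightarrow> t \<in> left_ends (p -` S \<gamma>')"
      using *(4) by (intro left_ends_local[of "p -` U"]) auto
    then show "of_bool (t \<in> left_ends (p -` S \<gamma>)) = (of_bool (t \<in> left_ends (p -` S \<gamma>')) :: nat)"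
      by simp
  qed
  moreover have "p t \<in> U1 \<union> U2" if "t \<in> Q" for t
    using that nodes_U frontier_U unfolding Q_def by blast
  ultimately show ?thesis
    unfolding c[OF closed(1)] c[OF closed(2)] c[OF closed(3)] c[OF closed(4)]
    by (intro germ_sum[where pt = p and \<phi> = "\<lambda>t \<gamma>. of_bool (t \<in> left_ends (p -` S \<gamma>))"]) auto
qed

lemma germ_local_vertices: "germ_local T D n (\<lambda>\<gamma>. n \<in> vertices T D \<gamma>)"
  unfolding germ_local_def vertices_def using incident_local by simp metis

lemma exchange_card_edges:
  "card (edges T D \<gamma>1) + card (edges T D \<gamma>2) = card (edges T D \<gamma>3) + card (edges T D \<gamma>4)"
  unfolding card_edges[OF closed(1)] card_edges[OF closed(2)] card_edges[OF closed(3)] card_edges[OF closed(4)]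
  unfolding sum.distrib[symmetric]
  using exchange_components[OF _ vertices_subset_nodes germ_local_vertices]
  by (intro sum.cong) (auto simp: lines_D_def)

lemma exchange_primary_edges:
  fixes act :: "point set \<Rightarrow> real"
  defines "W \<equiv> \<lambda>\<gamma>. \<Prod>e\<in>primary_edges T D \<gamma>. act (line_of T e)"
  shows "W \<gamma>1 * W \<gamma>2 = W \<gamma>3 * W \<gamma>4"
proof -
  have "germ_local T D n (\<lambda>\<gamma>. n \<in> {})" for n
    by (simp add: germ_local_def)
  then show ?thesis
    unfolding W_def prod_primary_edges[OF closed(1)] prod_primary_edges[OF closed(2)]
      prod_primary_edges[OF closed(3)] prod_primary_edges[OF closed(4)] prod.distrib[symmetric] power_add[symmetric]
    using exchange_components[of _ "\<lambda>_. {}"] by (intro prod.cong) (auto simp: lines_D_def)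
qed

end

text \<open>Extended reals disappear here: the weight is a product of powers and exponentials whose
  exponents obey the exchange identities, also when a base is 0.\<close>

lemma weight_eq:
  fixes act :: "point set \<Rightarrow> real" and k :: nat and \<alpha>V :: real and D :: "point set" and f :: config
  assumes "k \<ge> 2" "0 \<le> \<alpha>V" "\<alpha>V \<le> 1"
  defines "\<gamma> \<equiv> graph_of D f"
  shows "weight T act k \<alpha>V D f =
    \<alpha>V ^ N_V T D \<gamma> * ((real k - 1) * alpha_T k \<alpha>V) ^ N_T T D \<gamma> * ((real k - 1) * alpha_X \<alpha>V) ^ N_X T D \<gamma> *
    exp (- (real (card (edges T D \<gamma>)) * ln (real k - 1))) *
    exp (\<Sum>e\<in>edges T D \<gamma>. \<Sum>l\<in>{l \<in> T. crosses l e}. ln (1 - epsilon k \<alpha>V * act l)) *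
    exp (- (\<Sum>n\<in>nodes T \<inter> \<gamma>. ln (1 - \<alpha>V / (real k - 1) * (\<Prod>l\<in>{l \<in> T. n \<in> l}. act l)))) *
    (\<Prod>e\<in>primary_edges T D \<gamma>. act (line_of T e))"
proof -
  have X: "0 \<le> alpha_X \<alpha>V" "alpha_X \<alpha>V \<le> 1"
    using assms(2,3) by (auto simp: alpha_X_def)
  \<comment> \<open>This makes \<open>alpha_T\<close> nonnegative, as \<open>elog_weight\<close>
    requires of its bases.\<close>
  have "(real k - 2) / (real k - 1) * alpha_X \<alpha>V \<le> 1 * 1"
    using assms(1) X by (intro mult_mono) auto
  then have nonneg: "(real k - 1) * alpha_T k \<alpha>V \<ge> 0" "(real k - 1) * alpha_X \<alpha>V \<ge> 0"
    using assms(1) X by (auto simp: alpha_T_def)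
  define r1 where "r1 = real (card (edges T D \<gamma>)) * ln (real k - 1)"
  define r2 where "r2 = (\<Sum>e\<in>edges T D \<gamma>. \<Sum>l\<in>{l \<in> T. crosses l e}. ln (1 - epsilon k \<alpha>V * act l))"
  define r3 where "r3 = (\<Sum>n\<in>nodes T \<inter> \<gamma>. ln (1 - \<alpha>V / (real k - 1) * (\<Prod>l\<in>{l \<in> T. n \<in> l}. act l)))"
  have reorder: "x + ereal a - ereal b + ereal c = x + ereal (a - b + c)" for x a b c
    by (cases x) auto
  have "energy T act k \<alpha>V D \<gamma> = - (ereal (real (N_V T D \<gamma>)) * elog \<alpha>V)
     - ereal (real (N_T T D \<gamma>)) * elog ((real k - 1) * alpha_T k \<alpha>V)
     - ereal (real (N_X T D \<gamma>)) * elog ((real k - 1) * alpha_X \<alpha>V) + ereal (r1 - r2 + r3)"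
    unfolding energy_def r1_def[symmetric] r2_def[symmetric] r3_def[symmetric] by (rule reorder)
  note elog_weight[OF assms(2) nonneg this]
  then show ?thesis
    unfolding weight_def Let_def \<gamma>_def[symmetric] r1_def[symmetric] r2_def[symmetric] r3_def[symmetric]
    by (simp add: exp_add exp_diff exp_minus field_simps)
qed

lemma (in bounded_region) weight_nonneg:
  assumes "\<And>l. l \<in> T \<Longrightarrow> 0 < act l" "segment_closed T D (graph_of D f)"
  shows "weight T act k \<alpha>V D f \<ge> 0"
  unfolding weight_def Let_def prod_primary_edges[OF assms(2)] using assms(1)
  by (intro mult_nonneg_nonneg prod_nonneg) (auto simp: lines_D_def intro: less_imp_le)

context exchange
begin

text \<open>Corresponding factors of the two weights are multiplied first, so that each pair has the
  sum of two counts or of two real sums as exponent.\<close>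

lemma exchange_weight:
  assumes "k \<ge> 2" "0 \<le> \<alpha>V" "\<alpha>V \<le> 1"
    and "graph_of D f1 = \<gamma>1" "graph_of D f2 = \<gamma>2" "graph_of D f3 = \<gamma>3" "graph_of D f4 = \<gamma>4"
  shows "weight T act k \<alpha>V D f1 * weight T act k \<alpha>V D f2 = weight T act k \<alpha>V D f3 * weight T act k \<alpha>V D f4"
proof -
  have regroup: "(a * b * c * d * e * f * g) * (a' * b' * c' * d' * e' * f' * g') =
      (a * a') * (b * b') * (c * c') * (d * d') * (e * e') * (f * f') * (g * g')"
    for a b c d e f g a' b' c' d' e' f' g' :: real
    by (simp only: mult_ac)
  have 1: "exp (- (real (card (edges T D \<gamma>1)) * x)) * exp (- (real (card (edges T D \<gamma>2)) * x)) =
      exp (- (real (card (edges T D \<gamma>3)) * x)) * exp (- (real (card (edges T D \<gamma>4)) * x))" for x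
    using arg_cong[OF exchange_card_edges, of "\<lambda>n. exp (- (real n * x))"]
    by (simp add: exp_add[symmetric] algebra_simps)
  have 2: "exp (- sum g (nodes T \<inter> \<gamma>1)) * exp (- sum g (nodes T \<inter> \<gamma>2)) =
      exp (- sum g (nodes T \<inter> \<gamma>3)) * exp (- sum g (nodes T \<inter> \<gamma>4))" for g :: "point \<Rightarrow> real"
    using arg_cong[OF exchange_node_sum[of g], of "\<lambda>n. exp (- n)"]
    by (simp add: exp_add[symmetric] algebra_simps)
  show ?thesis
    unfolding weight_eq[OF assms(1-3)] assms(4-7) regroup power_add[symmetric]
      exchange_num_vertices exchange_primary_edges 1 2
    by (simp only: mult_exp_exp exchange_crossings)
qed

end

section \<open>Windows and the law of the field in a window\<close>

lemma line_sphere_card: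
  fixes z v :: "'a :: real_inner"
  assumes "norm v = 1" "norm z < R"
  shows "card (range (\<lambda>t::real. z + t *\<^sub>R v) \<inter> sphere 0 R) = 2"
proof -
  \<comment> \<open>The condition for lying on the sphere is a quadratic equation in
    \<open>t\<close>; completing the square gives the roots \<open>- b + d\<close> and
    \<open>- b - d\<close>, which differ because \<open>z\<close> is strictly inside.\<close>
  define b where "b = z \<bullet> v"
  define d where "d = sqrt (b\<^sup>2 + (R\<^sup>2 - (norm z)\<^sup>2))"
  have R: "R > 0"
    using assms(2) norm_ge_zero[of z] by linarith
  then have "(norm z)\<^sup>2 < R\<^sup>2"
    using assms(2) by (simp add: power_strict_mono)
  then have d: "d > 0" "d\<^sup>2 = b\<^sup>2 + (R\<^sup>2 - (norm z)\<^sup>2)"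
    unfolding d_def by (auto intro: add_nonneg_pos)
  have on_sphere: "z + t *\<^sub>R v \<in> sphere 0 R \<longleftrightarrow> t = - b + d \<or> t = - b - d" for t
  proof -
    have "z + t *\<^sub>R v \<in> sphere 0 R \<longleftrightarrow> (norm (z + t *\<^sub>R v))\<^sup>2 = R\<^sup>2"
      using R by (auto simp: power2_eq_iff_nonneg)
    also have "(norm (z + t *\<^sub>R v))\<^sup>2 = (norm z)\<^sup>2 + 2 * t * b + t\<^sup>2"
      using assms(1) unfolding b_def power2_norm_eq_inner
      by (simp add: inner_add_left inner_add_right inner_commute norm_eq_1 power2_eq_square)
    also have "\<dots> = R\<^sup>2 \<longleftrightarrow> (t + b)\<^sup>2 = d\<^sup>2"
      unfolding d(2) by (auto simp: power2_eq_square algebra_simps)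
    also have "\<dots> \<longleftrightarrow> t = - b + d \<or> t = - b - d"
      unfolding power2_eq_iff by auto
    finally show ?thesis .
  qed
  have "range (\<lambda>t. z + t *\<^sub>R v) \<inter> sphere 0 R = (\<lambda>t. z + t *\<^sub>R v) ` {t. z + t *\<^sub>R v \<in> sphere 0 R}"
    by blast
  also have "{t. z + t *\<^sub>R v \<in> sphere 0 R} = {- b + d, - b - d}"
    unfolding on_sphere by blast
  finally have "range (\<lambda>t. z + t *\<^sub>R v) \<inter> sphere 0 R = {z + (- b + d) *\<^sub>R v, z + (- b - d) *\<^sub>R v}"
    by simp
  moreover have "z + (- b + d) *\<^sub>R v \<noteq> z + (- b - d) *\<^sub>R v"
    using assms(1) d(1) by auto
  ultimately show ?thesis
    by simp
qed

context tessellation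
begin

text \<open>Only countably many radii are bad: norms of nodes, which would put a node on the circle,
  and distances of lines from 0, which would make a line tangent. An interval of radii is
  uncountable.\<close>

lemma exists_window_ball: "\<exists>R>r. window T (ball 0 R)"
proof -
  have "nodes T = (\<Union>n. nodes T \<inter> ball 0 (real n))"
    using reals_Archimedean2 by (auto simp: dist_norm)
  also have "countable \<dots>"
    using finite_nodes by (intro countable_UN) (auto intro: countable_finite)
  finally have "countable (nodes T)" .
  moreover have "countable T"
    using regular by (simp add: regular_tessellation_def)
  ultimately have "countable (norm ` nodes T \<union> infdist 0 ` T)"
    by simp
  moreover have "uncountable {max r 0<..<max r 0 + 1}"
    by (simp add: uncountable_open_interval)
  ultimately have "\<not> {max r 0<..<max r 0 + 1} \<subseteq> norm ` nodes T \<union> infdist 0 ` T"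
    using countable_subset by blast
  then obtain R where "R \<in> {max r 0<..<max r 0 + 1}" "R \<notin> norm ` nodes T \<union> infdist 0 ` T"
    by blast
  then have R: "R > r" "R > 0" "R \<notin> norm ` nodes T" "R \<notin> infdist 0 ` T"
    by auto
  have "card (l \<inter> sphere 0 R) = 2" if l: "l \<in> T" "l \<inter> cball 0 R \<noteq> {}" for l
  proof -
    obtain y where y: "y \<in> l" "norm y \<le> R"
      using l(2) by auto
    have "infdist 0 l \<le> norm y"
      using infdist_le[OF y(1), of 0] by simp
    then have "infdist 0 l < R"
      using y(2) R(4) l(1) by (metis image_eqI le_less_trans less_le order_trans)
    moreover have "l \<noteq> {}"
      using y by blast
    ultimately obtain z where z: "z \<in> l" "norm z < R"
      using infdist_attains_inf[OF line_closed[OF l(1)], of 0] by (metis dist_0_norm)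
    obtain a v where v: "norm v = 1" "l = range (\<lambda>t. a + t *\<^sub>R v)"
      using line_param[OF l(1)] .
    obtain s where s: "z = a + s *\<^sub>R v"
      using z v by blast
    have "l = range (\<lambda>t. z + t *\<^sub>R v)"
    proof (unfold v(2) s, intro equalityI subsetI; clarify)
      fix t show "a + t *\<^sub>R v \<in> range (\<lambda>t. a + s *\<^sub>R v + t *\<^sub>R v)"
        by (intro image_eqI[of _ _ "t - s"]) (auto simp: algebra_simps)
    next
      fix t show "a + s *\<^sub>R v + t *\<^sub>R v \<in> range (\<lambda>t. a + t *\<^sub>R v)"
        by (intro image_eqI[of _ _ "s + t"]) (auto simp: algebra_simps)
    qed
    then show ?thesis
      using line_sphere_card[OF v(1) z(2)] by simp
  qed
  then have "window T (ball 0 R)"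
    using R by (auto simp: window_def)
  then show ?thesis
    using R(1) by blast
qed

lemma window_bounded_region:
  assumes "window T D" shows "bounded_region T D"
proof unfold_locales
  show "open D" "bounded D"
    using assms by (auto simp: window_def)
  fix l assume l: "l \<in> T"
  show "finite (l \<inter> frontier D)"
  proof (cases "l \<inter> closure D = {}")
    case True
    then have "l \<inter> frontier D = {}"
      by (auto simp: frontier_def)
    then show ?thesis
      by simp
  next
    case False
    then have "card (l \<inter> frontier D) = 2"
      using assms l by (auto simp: window_def)
    then show ?thesis
      by (intro card_ge_0_finite) simp
  qed
qed

text \<open>Removing vertices from the graph removes only nodes, so away from nodes the open edges
  cover the graph. This translates the intersections with edges into values of the
  configuration.\<close>

lemma mem_edges_whole_plane_iff:
  assumes "f \<in> admissible T k UNIV" "x \<notin> nodes T"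
  shows "x \<in> \<Union>(edges T UNIV (graph_of UNIV f)) \<longleftrightarrow> f x = None"
proof -
  let ?\<gamma> = "graph_of UNIV f"
  have closed: "segment_closed T UNIV ?\<gamma>"
    using admissible_segment_closed[OF assms(1)] .
  have at_x: "x \<in> s" if s: "s \<in> segments T UNIV" "x \<in> closure s" for s
  proof -
    obtain l where "l \<in> T" "closure s \<subseteq> l"
      using segmentE[OF s(1)] .
    then show ?thesis
      using closure_segment_nonnode[OF s] assms(2) s(2) by blast
  qed
  have "x \<in> \<Union>(edges T UNIV ?\<gamma>) \<longleftrightarrow> (\<exists>l\<in>T. x \<in> graph_on_line T UNIV ?\<gamma> l)"
  proof -
    have "x \<in> \<Union>(components (graph_on_line T UNIV ?\<gamma> l - vertices T UNIV ?\<gamma>)) \<longleftrightarrow> x \<in> graph_on_line T UNIV ?\<gamma> l" for l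
      using assms(2) by (simp add: vertices_def Union_components[symmetric])
    then show ?thesis
      unfolding edges_def by blast
  qed
  also have "\<dots> \<longleftrightarrow> (\<exists>l\<in>T. \<exists>s\<in>segments T UNIV. s \<subseteq> ?\<gamma> \<and> s \<subseteq> l \<and> x \<in> s)"
  proof -
    have "x \<in> closure s \<longleftrightarrow> x \<in> s" if "s \<in> segments T UNIV" for s
      using at_x[OF that] closure_subset[of s] by blast
    then show ?thesis
      unfolding graph_on_line_def graph_segments_def by blast
  qed
  also have "\<dots> \<longleftrightarrow> (\<exists>s\<in>segments T UNIV. s \<subseteq> ?\<gamma> \<and> x \<in> s)"
  proof -
    have "\<exists>l\<in>T. s \<subseteq> l" if s: "s \<in> segments T UNIV" for s
    proof -
      obtain l where "l \<in> T" "closure s \<subseteq> l"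
        using segmentE[OF s] .
      then show ?thesis
        using closure_subset[of s] by blast
    qed
    then show ?thesis
      by blast
  qed
  also have "\<dots> \<longleftrightarrow> x \<in> ?\<gamma>"
  proof
    assume x: "x \<in> ?\<gamma>"
    obtain \<sigma> where "f = coloured_graph T UNIV \<sigma>"
      using assms(1) by (auto simp: admissible_def)
    then obtain s where s: "s \<in> segments T UNIV" "x \<in> closure s"
      using x by (auto simp: graph_of_coloured_graph separating_segments_def)
    have "x \<in> s"
      using at_x[OF s] .
    then have "s \<inter> ?\<gamma> \<noteq> {}"
      using x by blast
    then have "s \<subseteq> ?\<gamma>"
      using closed s(1) unfolding segment_closed_def by simp
    then show "\<exists>s\<in>segments T UNIV. s \<subseteq> ?\<gamma> \<and> x \<in> s"
      using s(1) \<open>x \<in> s\<close> by blast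
  qed blast
  finally show ?thesis
    by (simp add: graph_of_def)
qed

end

text \<open>The map that sends \<open>(f, f')\<close> to \<open>(sw f f', sw f' f)\<close> is its
  own inverse. It keeps the inner parts in place and swaps the outer ones, so the outer condition
  \<open>B\<close> passes from the first component to the second. Extensionality ensures that
  swapping twice gives back the same functions.\<close>

lemma sum_mult_exchange:
  fixes w :: "('a \<Rightarrow> 'b) \<Rightarrow> real" and F :: "('a \<Rightarrow> 'b) set" and D I K :: "'a set"
  defines "sw \<equiv> \<lambda>f f'. (\<lambda>x\<in>D. if x \<in> I then f x else f' x)"
  assumes ext: "F \<subseteq> extensional D" and sub: "I \<subseteq> D" "K \<subseteq> D - I"
    and sw: "\<And>f f'. \<lbrakk>f \<in> F; f' \<in> F; restrict f K = restrict f' K\<rbrakk> \<Longrightarrow> sw f f' \<in> F"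
    and w: "\<And>f f'. \<lbrakk>f \<in> F; f' \<in> F; restrict f K = restrict f' K\<rbrakk> \<Longrightarrow> w f * w f' = w (sw f f') * w (sw f' f)"
  shows "(\<Sum>f\<in>F \<inter> {f. restrict f I \<in> A \<and> restrict f (D - I) \<in> B \<and> restrict f K = t}. w f) *
      (\<Sum>f\<in>F \<inter> {f. restrict f K = t}. w f) =
    (\<Sum>f\<in>F \<inter> {f. restrict f I \<in> A \<and> restrict f K = t}. w f) *
      (\<Sum>f\<in>F \<inter> {f. restrict f (D - I) \<in> B \<and> restrict f K = t}. w f)"
    (is "sum w ?AB * sum w ?T = sum w ?A * sum w ?B")
proof -
  have sw_I: "restrict (sw f f') I = restrict f I" for f f'
    using sub by (auto simp: sw_def restrict_def fun_eq_iff)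
  have sw_O: "restrict (sw f f') (D - I) = restrict f' (D - I)" for f f'
    by (auto simp: sw_def restrict_def fun_eq_iff)
  have sw_K: "restrict (sw f f') K = restrict f' K" for f f'
    using sub by (auto simp: sw_def restrict_def fun_eq_iff)
  have sw_sw: "sw (sw f f') (sw f' f) = f" if "f \<in> F" for f f'
    using that ext by (auto simp: sw_def restrict_def fun_eq_iff extensional_def)
  let ?h = "\<lambda>(f, f'). (sw f f', sw f' f)"
  have "sum w ?AB * sum w ?T = (\<Sum>(f, f')\<in>?AB \<times> ?T. w f * w f')"
    by (simp add: sum_product sum.cartesian_product)
  also have "\<dots> = (\<Sum>(f, f')\<in>?A \<times> ?B. w f * w f')"
  proof (rule sum.reindex_bij_witness[where i = ?h and j = ?h])
    fix z assume "z \<in> ?AB \<times> ?T"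
    then obtain f f' where z: "z = (f, f')" "f \<in> ?AB" "f' \<in> ?T"
      by auto
    have "f \<in> F" "f' \<in> F" and eq: "restrict f K = restrict f' K"
      using z by auto
    note sw[OF this] sw[OF this(2,1) eq[symmetric]]
    then show "?h z \<in> ?A \<times> ?B"
      using z by (simp add: sw_I sw_O sw_K)
    show "?h (?h z) = z"
      using z \<open>f \<in> F\<close> \<open>f' \<in> F\<close> by (simp add: sw_sw)
    show "(case ?h z of (f, f') \<Rightarrow> w f * w f') = (case z of (f, f') \<Rightarrow> w f * w f')"
      using z w[OF \<open>f \<in> F\<close> \<open>f' \<in> F\<close> eq] by simp
  next
    fix z assume "z \<in> ?A \<times> ?B"
    then obtain f f' where z: "z = (f, f')" "f \<in> ?A" "f' \<in> ?B"
      by auto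
    have "f \<in> F" "f' \<in> F" and eq: "restrict f K = restrict f' K"
      using z by auto
    note sw[OF this] sw[OF this(2,1) eq[symmetric]]
    then show "?h z \<in> ?AB \<times> ?T"
      using z by (simp add: sw_I sw_O sw_K)
    show "?h (?h z) = z"
      using z \<open>f \<in> F\<close> \<open>f' \<in> F\<close> by (simp add: sw_sw)
  qed
  also have "\<dots> = sum w ?A * sum w ?B"
    by (simp add: sum_product sum.cartesian_product)
  finally show ?thesis .
qed

section \<open>Events determined by the configuration in a set\<close>

lemma space_config_algebra [simp]: "space (config_algebra M X A) = space M"
  by (simp add: config_algebra_def)

lemma measurable_config_algebra:
  assumes "x \<in> A"
  shows "(\<lambda>\<omega>. X \<omega> x) \<in> config_algebra M X A \<rightarrow>\<^sub>M count_space UNIV"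
proof -
  have "(\<lambda>\<omega>. restrict (X \<omega>) A) \<in> config_algebra M X A \<rightarrow>\<^sub>M PiM A (\<lambda>_. count_space UNIV)"
    unfolding config_algebra_def by (intro measurable_vimage_algebra1) (auto simp: space_PiM)
  from measurable_compose[OF this measurable_component_singleton[OF assms]] show ?thesis
    using assms by simp
qed

lemma config_algebra_least:
  assumes "space N = space M" "\<And>x. x \<in> A \<Longrightarrow> (\<lambda>\<omega>. X \<omega> x) \<in> N \<rightarrow>\<^sub>M count_space UNIV"
  shows "sets (config_algebra M X A) \<subseteq> sets N"
  unfolding config_algebra_def
proof (rule sets_image_in_sets[OF assms(1)])
  show "(\<lambda>\<omega>. restrict (X \<omega>) A) \<in> N \<rightarrow>\<^sub>M PiM A (\<lambda>_. count_space UNIV)"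
    using assms(2) by (rule measurable_restrict)
qed

text \<open>No measurability of \<open>Y\<close> is recorded: the law in a window lives on a
  discrete space, where every set is an event.\<close>

lemma config_algebra_event:
  assumes "B \<in> sets (config_algebra M X A)"
  obtains Y where "B = {\<omega> \<in> space M. restrict (X \<omega>) A \<in> Y}"
proof -
  have "(\<lambda>\<omega>. restrict (X \<omega>) A) \<in> space M \<rightarrow> space (PiM A (\<lambda>_. count_space UNIV))"
    by (auto simp: space_PiM)
  then obtain Y where "B = (\<lambda>\<omega>. restrict (X \<omega>) A) -` Y \<inter> space M"
    using assms unfolding config_algebra_def by (auto simp: sets_vimage_algebra2)
  then show ?thesis
    using that[of Y] by blast
qed

section \<open>The law of the field in a window\<close>

locale polygonal_plane = tessellation T + prob_space M
  for T :: "point set set" and M :: "'w measure" +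
  fixes act :: "point set \<Rightarrow> real" and k :: nat and \<alpha>V :: real and X :: "'w \<Rightarrow> config"
  assumes act_pos: "\<And>l. l \<in> T \<Longrightarrow> 0 < act l"
    and k_ge_2: "k \<ge> 2" and \<alpha>V: "0 \<le> \<alpha>V" "\<alpha>V \<le> 1"
    and field: "whole_plane_field T act k \<alpha>V M X"
begin

abbreviation "W D \<equiv> weight T act k \<alpha>V D"

lemma measurable_coord: "(\<lambda>\<omega>. X \<omega> x) \<in> M \<rightarrow>\<^sub>M count_space UNIV"
proof -
  have "X \<in> M \<rightarrow>\<^sub>M PiM UNIV (\<lambda>_. count_space UNIV)"
    using field by (simp add: whole_plane_field_def)
  from measurable_compose[OF this measurable_component_singleton[of x]] show ?thesis
    by simp
qed

lemma measurable_window: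
  assumes "window T D"
  shows "(\<lambda>\<omega>. restrict (X \<omega>) D) \<in> M \<rightarrow>\<^sub>M count_space (admissible T k D)"
  using field assms by (simp add: whole_plane_field_def)

lemma window_event:
  assumes "window T D"
  shows "{\<omega> \<in> space M. restrict (X \<omega>) D \<in> S} \<in> events"
proof -
  have "(\<lambda>\<omega>. restrict (X \<omega>) D) -` (S \<inter> admissible T k D) \<inter> space M \<in> events"
    by (intro measurable_sets[OF measurable_window[OF assms]]) simp
  also have "(\<lambda>\<omega>. restrict (X \<omega>) D) -` (S \<inter> admissible T k D) \<inter> space M = {\<omega> \<in> space M. restrict (X \<omega>) D \<in> S}"
    using measurable_space[OF measurable_window[OF assms]] by auto
  finally show ?thesis .
qed

text \<open>Finiteness and positivity are read off from the law instead of the geometry: for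
  \<open>Z = 0\<close> all quotients in the density would be 0, against total mass 1.\<close>

lemma window_law:
  assumes "window T D"
  defines "Z \<equiv> \<Sum>f\<in>admissible T k D. W D f"
  shows "finite (admissible T k D)" "Z > 0"
    "prob {\<omega> \<in> space M. restrict (X \<omega>) D \<in> S} = (\<Sum>f\<in>admissible T k D \<inter> S. W D f) / Z"
proof -
  interpret bounded_region T D
    by (rule window_bounded_region[OF assms(1)])
  let ?F = "admissible T k D"
  let ?N = "polygonal_field T act k \<alpha>V D"
  have N: "?N = point_measure ?F (\<lambda>f. ennreal (W D f / Z))"
    by (simp add: polygonal_field_def Z_def)
  have distr: "distr M (count_space ?F) (\<lambda>\<omega>. restrict (X \<omega>) D) = ?N"
    using field assms(1) by (simp add: whole_plane_field_def)
  have nonneg: "W D f \<ge> 0" if "f \<in> ?F" for f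
    using weight_nonneg[OF act_pos admissible_segment_closed[OF that]] .
  have "prob_space ?N"
    unfolding distr[symmetric] by (intro prob_space_distr measurable_window[OF assms(1)])
  then have "emeasure ?N (space ?N) = 1"
    by (rule prob_space.emeasure_space_1)
  moreover have "emeasure ?N (space ?N) = 0" if "Z = 0"
    by (simp add: N that point_measure_def emeasure_density)
  ultimately have "Z \<noteq> 0"
    by auto
  \<comment> \<open>A sum over an infinite set is 0 by convention, so a nonzero \<open>Z\<close>
    leaves only the finite case.\<close>
  then show fin: "finite ?F"
    unfolding Z_def using sum.infinite by blast
  have "Z \<ge> 0"
    unfolding Z_def using nonneg by (rule sum_nonneg)
  then show Z: "Z > 0"
    using \<open>Z \<noteq> 0\<close> by simp
  have "emeasure M {\<omega> \<in> space M. restrict (X \<omega>) D \<in> S} =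
      emeasure (distr M (count_space ?F) (\<lambda>\<omega>. restrict (X \<omega>) D)) (?F \<inter> S)"
    using measurable_space[OF measurable_window[OF assms(1)]]
    by (subst emeasure_distr[OF measurable_window[OF assms(1)]]) (auto intro!: arg_cong[where f = "emeasure M"])
  also have "\<dots> = (\<Sum>f\<in>?F \<inter> S. ennreal (W D f / Z))"
    unfolding distr N using fin by (intro emeasure_point_measure_finite) auto
  also have "\<dots> = ennreal ((\<Sum>f\<in>?F \<inter> S. W D f) / Z)"
    using nonneg Z by (subst sum_ennreal) (auto simp: sum_divide_distrib)
  finally have "emeasure M {\<omega> \<in> space M. restrict (X \<omega>) D \<in> S} = ennreal ((\<Sum>f\<in>?F \<inter> S. W D f) / Z)" .
  moreover have "(\<Sum>f\<in>?F \<inter> S. W D f) / Z \<ge> 0"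
    using nonneg Z by (intro divide_nonneg_pos sum_nonneg) auto
  ultimately show "prob {\<omega> \<in> space M. restrict (X \<omega>) D \<in> S} = (\<Sum>f\<in>?F \<inter> S. W D f) / Z"
    unfolding measure_def by (simp only: enn2real_ennreal)
qed

lemma window_conditional_independence:
  assumes "window T D" "compact K" "K \<subseteq> D" "inside K \<subseteq> D" "K \<inter> nodes T = {}"
  shows "prob {\<omega> \<in> space M. restrict (X \<omega>) (inside K) \<in> A \<and> restrict (X \<omega>) (D - inside K) \<in> B \<and> restrict (X \<omega>) K = t} *
      prob {\<omega> \<in> space M. restrict (X \<omega>) K = t} =
    prob {\<omega> \<in> space M. restrict (X \<omega>) (inside K) \<in> A \<and> restrict (X \<omega>) K = t} *
      prob {\<omega> \<in> space M. restrict (X \<omega>) (D - inside K) \<in> B \<and> restrict (X \<omega>) K = t}"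
proof -
  interpret bounded_region T D
    by (rule window_bounded_region[OF assms(1)])
  let ?F = "admissible T k D" and ?I = "inside K"
  have cK: "closed K"
    using assms(2) by (rule compact_imp_closed)
  have KI: "K \<subseteq> D - ?I"
    using assms(3) inside_no_overlap[of K] by blast
  define sw where "sw = (\<lambda>f f' :: config. (\<lambda>x\<in>D. if x \<in> ?I then f x else f' x))"
  have sw_adm: "sw f f' \<in> ?F" if "f \<in> ?F" "f' \<in> ?F" "restrict f K = restrict f' K" for f f'
    unfolding sw_def by (rule admissible_swap[OF open_D assms(2,3,5) that])
  have io: "x \<notin> inside K" if "x \<in> outside K" for x
    using that inside_Int_outside[of K] by blast
  have graph_sw: "graph_of D (sw f f') \<inter> ?I = graph_of D f \<inter> ?I"
    "graph_of D (sw f f') \<inter> outside K = graph_of D f' \<inter> outside K" for f f'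
    by (auto simp: graph_of_def sw_def dest: io)
  have sw_weight: "W D f * W D f' = W D (sw f f') * W D (sw f' f)"
    if f: "f \<in> ?F" "f' \<in> ?F" "restrict f K = restrict f' K" for f f'
  proof -
    have "exchange T D ?I (outside K) (graph_of D f) (graph_of D f') (graph_of D (sw f f')) (graph_of D (sw f' f))"
    proof unfold_locales
      show "open ?I" "open (outside K)"
        using open_inside[OF cK] open_outside[OF cK] .
      show "nodes T \<inter> D \<subseteq> ?I \<union> outside K"
        using assms(5) inside_Un_outside[of K] by blast
      \<comment> \<open>Since \<open>K\<close> lies in the open window, the points where lines leave
        the window are not on \<open>K\<close>.\<close>
      have "frontier D \<inter> D = {}"
        using open_D by (auto simp: frontier_def interior_open)
      then show "frontier D \<subseteq> ?I \<union> outside K"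
        using assms(3) inside_Un_outside[of K] by blast
    qed (use f sw_adm[OF f] sw_adm[OF f(2,1) f(3)[symmetric]] graph_sw admissible_segment_closed in auto)
    then show ?thesis
      by (rule exchange.exchange_weight[OF _ k_ge_2 \<alpha>V]) auto
  qed
  have ext: "?F \<subseteq> extensional D"
    by (auto simp: admissible_def coloured_graph_def)
  define Z where "Z = (\<Sum>f\<in>?F. W D f)"
  have law: "prob {\<omega> \<in> space M. Q (restrict (X \<omega>) D)} = (\<Sum>f\<in>?F \<inter> {f. Q f}. W D f) / Z" for Q
    using window_law(3)[OF assms(1), of "{f. Q f}"] by (simp add: Z_def)
  have restr: "restrict (restrict (X \<omega>) D) ?I = restrict (X \<omega>) ?I"
    "restrict (restrict (X \<omega>) D) (D - ?I) = restrict (X \<omega>) (D - ?I)"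
    "restrict (restrict (X \<omega>) D) K = restrict (X \<omega>) K" for \<omega>
    using assms(3,4) by (auto simp: restrict_def fun_eq_iff)
  note exch = sum_mult_exchange[OF ext assms(4) KI, of "W D" A B t, OF sw_adm[unfolded sw_def] sw_weight[unfolded sw_def]]
  note laws = law[of "\<lambda>f. restrict f ?I \<in> A \<and> restrict f (D - ?I) \<in> B \<and> restrict f K = t", unfolded restr]
    law[of "\<lambda>f. restrict f K = t", unfolded restr]
    law[of "\<lambda>f. restrict f ?I \<in> A \<and> restrict f K = t", unfolded restr]
    law[of "\<lambda>f. restrict f (D - ?I) \<in> B \<and> restrict f K = t", unfolded restr]
  show ?thesis
    unfolding laws times_divide_times_eq by (rule arg_cong[where f = "\<lambda>x. x / (Z * Z)", OF exch])
qed

end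

section \<open>The Markov property\<close>

locale polygonal_plane_compact = polygonal_plane T M act k \<alpha>V X
  for T and M :: "'w measure" and act k \<alpha>V X +
  fixes K :: "point set"
  assumes compact_K: "compact K" and K_nodes: "K \<inter> nodes T = {}"
begin

abbreviation "exterior_algebra \<equiv> config_algebra M X (- inside K)"
abbreviation "K_algebra \<equiv> trace_algebra T M X K"
definition "on_K t = {\<omega> \<in> space M. restrict (X \<omega>) K = t}"

text \<open>Balls are used because they are nested: the larger of two radii serves both, and large
  ones reach any given point.\<close>

definition "big_ball R \<longleftrightarrow> window T (ball 0 R) \<and> K \<subseteq> ball 0 R \<and> inside K \<subseteq> ball 0 R"

lemma big_ball_exists: "\<exists>R>r. big_ball R"
proof -
  have "bounded (K \<union> inside K)"
    using bounded_inside[of K] compact_imp_bounded[OF compact_K] by auto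
  then obtain b where b: "\<And>x. x \<in> K \<union> inside K \<Longrightarrow> norm x \<le> b"
    unfolding bounded_iff by blast
  obtain R where R: "R > max r b" "window T (ball 0 R)"
    using exists_window_ball by blast
  have "norm x < R" if "x \<in> K \<union> inside K" for x
    using b[OF that] R(1) by simp
  then have "big_ball R"
    using R(2) by (auto simp: big_ball_def)
  then show ?thesis
    using R(1) by auto
qed

lemma restrict_event:
  assumes "big_ball R" "A \<subseteq> ball 0 R"
  shows "{\<omega> \<in> space M. restrict (X \<omega>) A \<in> Y} \<in> events"
proof -
  have "restrict (restrict (X \<omega>) (ball 0 R)) A = restrict (X \<omega>) A" for \<omega>
    using assms(2) by (auto simp: restrict_def fun_eq_iff)
  then show ?thesis
    using window_event[of "ball 0 R" "{f. restrict f A \<in> Y}"] assms(1) by (simp add: big_ball_def)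
qed

lemma on_K_event: "on_K t \<in> events"
proof -
  obtain R where "big_ball R"
    using big_ball_exists by blast
  then show ?thesis
    using restrict_event[of R K "{t}"] unfolding on_K_def by (simp add: big_ball_def)
qed

lemma inside_event:
  assumes "A \<in> sets (config_algebra M X (inside K))" shows "A \<in> events"
proof -
  obtain R where "big_ball R"
    using big_ball_exists by blast
  moreover obtain Y where "A = {\<omega> \<in> space M. restrict (X \<omega>) (inside K) \<in> Y}"
    using config_algebra_event[OF assms] .
  ultimately show ?thesis
    using restrict_event[of R "inside K" Y] by (simp add: big_ball_def)
qed

lemma exterior_sub: "sets exterior_algebra \<subseteq> events"
  by (rule config_algebra_least[OF refl measurable_coord])

section \<open>From windows to all exterior events\<close>

definition "exterior_cylinders =
  {{\<omega> \<in> space M. restrict (X \<omega>) (ball 0 R - inside K) \<in> Y} | R Y. big_ball R}"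

lemma exterior_cylinders_events: "exterior_cylinders \<subseteq> events"
  using restrict_event by (auto simp: exterior_cylinders_def)

lemma Int_stable_exterior_cylinders: "Int_stable exterior_cylinders"
proof (rule Int_stableI)
  fix B1 B2 assume "B1 \<in> exterior_cylinders" "B2 \<in> exterior_cylinders"
  then obtain R1 Y1 R2 Y2 where B: "big_ball R1" "big_ball R2"
    "B1 = {\<omega> \<in> space M. restrict (X \<omega>) (ball 0 R1 - inside K) \<in> Y1}"
    "B2 = {\<omega> \<in> space M. restrict (X \<omega>) (ball 0 R2 - inside K) \<in> Y2}"
    unfolding exterior_cylinders_def by blast
  define R where "R = max R1 R2"
  have "restrict (restrict (X \<omega>) (ball 0 R - inside K)) (ball 0 R1 - inside K) = restrict (X \<omega>) (ball 0 R1 - inside K)"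
    "restrict (restrict (X \<omega>) (ball 0 R - inside K)) (ball 0 R2 - inside K) = restrict (X \<omega>) (ball 0 R2 - inside K)" for \<omega>
    by (auto simp: R_def restrict_def fun_eq_iff)
  then have "B1 \<inter> B2 = {\<omega> \<in> space M. restrict (X \<omega>) (ball 0 R - inside K) \<in>
      {f. restrict f (ball 0 R1 - inside K) \<in> Y1 \<and> restrict f (ball 0 R2 - inside K) \<in> Y2}}"
    using B by auto
  moreover have "big_ball R"
    using B(1,2) by (auto simp: R_def max_def)
  ultimately show "B1 \<inter> B2 \<in> exterior_cylinders"
    unfolding exterior_cylinders_def by blast
qed

lemma exterior_generated: "sets exterior_algebra \<subseteq> sigma_sets (space M) exterior_cylinders"
proof -
  have pow: "exterior_cylinders \<subseteq> Pow (space M)"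
    by (auto simp: exterior_cylinders_def)
  have "sets exterior_algebra \<subseteq> sets (sigma (space M) exterior_cylinders)"
  proof (rule config_algebra_least)
    show "space (sigma (space M) exterior_cylinders) = space M"
      by (rule space_measure_of_conv)
    fix x assume x: "x \<in> - inside K"
    obtain R where R: "R > norm x" "big_ball R"
      using big_ball_exists by blast
    show "(\<lambda>\<omega>. X \<omega> x) \<in> sigma (space M) exterior_cylinders \<rightarrow>\<^sub>M count_space UNIV"
    proof (rule measurableI)
      fix S
      have "(\<lambda>\<omega>. X \<omega> x) -` S \<inter> space M =
          {\<omega> \<in> space M. restrict (X \<omega>) (ball 0 R - inside K) \<in> {f. f x \<in> S}}"
        using x R(1) by auto
      then have "(\<lambda>\<omega>. X \<omega> x) -` S \<inter> space M \<in> exterior_cylinders"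
        unfolding exterior_cylinders_def using R(2) by blast
      then show "(\<lambda>\<omega>. X \<omega> x) -` S \<inter> space (sigma (space M) exterior_cylinders) \<in> sets (sigma (space M) exterior_cylinders)"
        unfolding space_measure_of_conv sets_measure_of[OF pow] by (rule sigma_sets.Basic)
    qed simp
  qed
  then show ?thesis
    unfolding sets_measure_of[OF pow] .
qed

text \<open>For fixed \<open>A\<close> and \<open>t\<close> both sides are finite measures in
  \<open>B\<close>, equal on the cylinders by the result in a window. A quotient by
  \<open>prob (on_K t)\<close> would be meaningless for a null trace.\<close>

lemma exterior_conditional_independence:
  assumes A: "A \<in> sets (config_algebra M X (inside K))" and B: "B \<in> sets exterior_algebra"
  shows "prob (A \<inter> B \<inter> on_K t) * prob (on_K t) = prob (A \<inter> on_K t) * prob (B \<inter> on_K t)"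
proof -
  obtain YA where YA: "A = {\<omega> \<in> space M. restrict (X \<omega>) (inside K) \<in> YA}"
    using config_algebra_event[OF A] .
  have [measurable]: "A \<in> events" "on_K t \<in> events"
    using inside_event[OF A] on_K_event .
  have sub: "exterior_cylinders \<subseteq> Pow (space M)"
    using exterior_cylinders_events sets.sets_into_space by blast
  have gen: "sigma_sets (space M) exterior_cylinders \<subseteq> events"
    using exterior_cylinders_events by (rule sets.sigma_sets_subset)
  have "B \<in> sigma_sets (space M) exterior_cylinders"
    using B exterior_generated by blast
  with Int_stable_exterior_cylinders sub show ?thesis
  proof (induction rule: sigma_sets_induct_disjoint)
    case (basic B)
    then obtain R Y where R: "big_ball R" "B = {\<omega> \<in> space M. restrict (X \<omega>) (ball 0 R - inside K) \<in> Y}"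
      unfolding exterior_cylinders_def by blast
    have "A \<inter> B \<inter> on_K t = {\<omega> \<in> space M. restrict (X \<omega>) (inside K) \<in> YA \<and>
        restrict (X \<omega>) (ball 0 R - inside K) \<in> Y \<and> restrict (X \<omega>) K = t}"
      "A \<inter> on_K t = {\<omega> \<in> space M. restrict (X \<omega>) (inside K) \<in> YA \<and> restrict (X \<omega>) K = t}"
      "B \<inter> on_K t = {\<omega> \<in> space M. restrict (X \<omega>) (ball 0 R - inside K) \<in> Y \<and> restrict (X \<omega>) K = t}"
      using YA R(2) by (auto simp: on_K_def)
    moreover have "window T (ball 0 R)" "K \<subseteq> ball 0 R" "inside K \<subseteq> ball 0 R"
      using R(1) by (auto simp: big_ball_def)
    note window_conditional_independence[OF this(1) compact_K this(2,3) K_nodes, of YA Y t]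
    ultimately show ?case
      by (simp only: on_K_def)
  next
    case empty
    then show ?case by simp
  next
    case (compl B)
    have [measurable]: "B \<in> events"
      using compl(1) gen by blast
    have "A \<inter> (space M - B) \<inter> on_K t = (A \<inter> on_K t) - (A \<inter> B \<inter> on_K t)"
      using sets.sets_into_space[OF \<open>A \<in> events\<close>] by blast
    then have 1: "prob (A \<inter> (space M - B) \<inter> on_K t) = prob (A \<inter> on_K t) - prob (A \<inter> B \<inter> on_K t)"
      using finite_measure_Diff[of "A \<inter> on_K t" "A \<inter> B \<inter> on_K t"] by auto
    have "(space M - B) \<inter> on_K t = on_K t - (B \<inter> on_K t)"
      by (auto simp: on_K_def)
    then have 2: "prob ((space M - B) \<inter> on_K t) = prob (on_K t) - prob (B \<inter> on_K t)"
      using finite_measure_Diff[of "on_K t" "B \<inter> on_K t"] by auto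
    show ?case
      unfolding 1 2 using compl(2) by (simp add: algebra_simps)
  next
    case (union B)
    have B [measurable]: "\<And>i. B i \<in> events"
      using union(2) gen by blast
    have "(\<lambda>i. prob (A \<inter> B i \<inter> on_K t)) sums prob (\<Union>i. A \<inter> B i \<inter> on_K t)"
      using union(1) by (intro finite_measure_UNION) (auto simp: disjoint_family_on_def)
    moreover have "(\<lambda>i. prob (B i \<inter> on_K t)) sums prob (\<Union>i. B i \<inter> on_K t)"
      using union(1) by (intro finite_measure_UNION) (auto simp: disjoint_family_on_def)
    moreover have "(\<Union>i. A \<inter> B i \<inter> on_K t) = A \<inter> (\<Union>i. B i) \<inter> on_K t" "(\<Union>i. B i \<inter> on_K t) = (\<Union>i. B i) \<inter> on_K t"
      by auto
    ultimately have "(\<lambda>i. prob (A \<inter> B i \<inter> on_K t) * prob (on_K t)) sums (prob (A \<inter> (\<Union>i. B i) \<inter> on_K t) * prob (on_K t))"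
      "(\<lambda>i. prob (A \<inter> on_K t) * prob (B i \<inter> on_K t)) sums (prob (A \<inter> on_K t) * prob ((\<Union>i. B i) \<inter> on_K t))"
      by (auto intro: sums_mult sums_mult2)
    then show ?case
      unfolding union(3) by (rule sums_unique2)
  qed
qed

text \<open>One fixed window already bounds the possible configurations along \<open>K\<close>,
  which makes their number finite.\<close>

definition "traces = (\<lambda>f. restrict f K) ` admissible T k (ball 0 (SOME R. big_ball R))"

lemma finite_traces: "finite traces" and restrict_K_traces: "\<omega> \<in> space M \<Longrightarrow> restrict (X \<omega>) K \<in> traces"
proof -
  define D :: "point set" where "D = ball 0 (SOME R. big_ball R)"
  have "big_ball (SOME R. big_ball R)"
    using big_ball_exists by (metis someI)
  then have D: "window T D" "K \<subseteq> D"
    by (auto simp: big_ball_def D_def)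
  show "finite traces"
    unfolding traces_def using window_law(1)[OF D(1)] by (simp add: D_def)
  have "restrict (X \<omega>) K = restrict (restrict (X \<omega>) D) K"
    using D(2) by (auto simp: restrict_def fun_eq_iff)
  moreover have "restrict (X \<omega>) D \<in> admissible T k D" if "\<omega> \<in> space M"
    using measurable_space[OF measurable_window[OF D(1)] that] by simp
  ultimately show "restrict (X \<omega>) K \<in> traces" if "\<omega> \<in> space M"
    using that unfolding traces_def D_def[symmetric] by blast
qed

text \<open>Being on an edge is the value \<open>None\<close> at points of \<open>K\<close>, since
  \<open>K\<close> has no nodes. Edges and colours together are therefore exactly the coordinates
  along \<open>K\<close>.\<close>

lemma trace_generators:
  "{{\<omega> \<in> space M. x \<in> \<Union>(edges T UNIV (graph_of UNIV (X \<omega>)))} | x. x \<in> K} \<union>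
   {{\<omega> \<in> space M. X \<omega> x = Some c} | x c. x \<in> K} = {{\<omega> \<in> space M. X \<omega> x = v} | x v. x \<in> K}"
    (is "?L = ?R")
proof -
  have "{\<omega> \<in> space M. x \<in> \<Union>(edges T UNIV (graph_of UNIV (X \<omega>)))} = {\<omega> \<in> space M. X \<omega> x = None}"
    if "x \<in> K" for x
  proof -
    have "X \<omega> \<in> admissible T k UNIV" if "\<omega> \<in> space M" for \<omega>
      using field that by (simp add: whole_plane_field_def)
    then show ?thesis
      using mem_edges_whole_plane_iff that K_nodes by blast
  qed
  then have "{{\<omega> \<in> space M. x \<in> \<Union>(edges T UNIV (graph_of UNIV (X \<omega>)))} | x. x \<in> K} =
      {{\<omega> \<in> space M. X \<omega> x = None} | x. x \<in> K}"
    by (metis (no_types, lifting))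
  then have "?L = {{\<omega> \<in> space M. X \<omega> x = None} | x. x \<in> K} \<union> {{\<omega> \<in> space M. X \<omega> x = Some c} | x c. x \<in> K}"
    by simp
  also have "\<dots> = ?R"
  proof (intro equalityI subsetI)
    fix E assume "E \<in> ?R"
    then obtain x v where "E = {\<omega> \<in> space M. X \<omega> x = v}" "x \<in> K"
      by blast
    then show "E \<in> {{\<omega> \<in> space M. X \<omega> x = None} | x. x \<in> K} \<union> {{\<omega> \<in> space M. X \<omega> x = Some c} | x c. x \<in> K}"
      by (cases v) blast+
  qed blast
  finally show ?thesis .
qed

lemma trace_eq: "K_algebra = sigma (space M) {{\<omega> \<in> space M. X \<omega> x = v} | x v. x \<in> K}"
  unfolding trace_algebra_def trace_generators ..

lemma space_trace [simp]: "space K_algebra = space M"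
  unfolding trace_eq by (rule space_measure_of_conv)

lemma trace_coord:
  assumes "x \<in> K" shows "{\<omega> \<in> space M. X \<omega> x = v} \<in> sets K_algebra"
  unfolding trace_eq using assms by (subst sets_measure_of) auto

lemma trace_sub_exterior: "sets K_algebra \<subseteq> sets exterior_algebra"
proof -
  have "{\<omega> \<in> space M. X \<omega> x = v} \<in> sets exterior_algebra" if "x \<in> K" for x v
  proof -
    have "x \<in> - inside K"
      using that inside_no_overlap[of K] by blast
    from measurable_sets[OF measurable_config_algebra[OF this, of X M], of "{v}"] show ?thesis
      by (simp add: vimage_def Int_def conj_commute)
  qed
  then have "{{\<omega> \<in> space M. X \<omega> x = v} | x v. x \<in> K} \<subseteq> sets exterior_algebra"
    by blast
  from sets.sigma_sets_subset[OF this] show ?thesis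
    unfolding trace_eq by (subst sets_measure_of) auto
qed

text \<open>As only finitely many traces are possible, one is determined by its values at
  finitely many points of \<open>K\<close>.\<close>

lemma on_K_trace:
  assumes "t \<in> traces" shows "on_K t \<in> sets K_algebra"
proof -
  have ext: "u \<in> extensional K" if "u \<in> traces" for u
    using that by (auto simp: traces_def)
  have "\<exists>x\<in>K. u x \<noteq> t x" if "u \<in> traces" "u \<noteq> t" for u
    using that ext assms by (metis extensionalityI)
  \<comment> \<open>\<open>p u\<close> is a point of \<open>K\<close> that tells the trace
    \<open>u\<close> from \<open>t\<close>.\<close>
  then obtain p where p: "\<And>u. \<lbrakk>u \<in> traces; u \<noteq> t\<rbrakk> \<Longrightarrow> p u \<in> K \<and> u (p u) \<noteq> t (p u)"
    by metis
  have "on_K t = space M \<inter> (\<Inter>u\<in>traces - {t}. {\<omega> \<in> space M. X \<omega> (p u) = t (p u)})" (is "_ = ?E")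
  proof (intro equalityI subsetI)
    fix \<omega> assume "\<omega> \<in> on_K t"
    then have \<omega>: "\<omega> \<in> space M" "t = restrict (X \<omega>) K"
      by (auto simp: on_K_def)
    have "X \<omega> (p u) = t (p u)" if "u \<in> traces" "u \<noteq> t" for u
      using p[OF that] \<omega>(2) by simp
    then show "\<omega> \<in> ?E"
      using \<omega>(1) by simp
  next
    fix \<omega> assume \<omega>: "\<omega> \<in> ?E"
    define u where "u = restrict (X \<omega>) K"
    have "u \<in> traces"
      using restrict_K_traces \<omega> by (simp add: u_def)
    have "u = t"
    proof (rule ccontr)
      assume "u \<noteq> t"
      then have "p u \<in> K" "u (p u) \<noteq> t (p u)" "X \<omega> (p u) = t (p u)"
        using p[OF \<open>u \<in> traces\<close>] \<omega> \<open>u \<in> traces\<close> by auto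
      then show False
        by (simp add: u_def)
    qed
    then show "\<omega> \<in> on_K t"
      using \<omega> by (simp add: u_def on_K_def)
  qed
  also have "\<dots> \<in> sets K_algebra"
    \<comment> \<open>The case distinction is due to \<open>sets.finite_INT\<close>, which needs a
      nonempty index set.\<close>
    using finite_traces p trace_coord sets.top[of K_algebra]
    by (cases "traces - {t} = {}") (auto intro!: sets.Int sets.finite_INT)
  finally show ?thesis .
qed

text \<open>The right-hand side is measurable already for the algebra along \<open>K\<close>, and
  its integrals are correct even over all exterior events. So it represents the conditional
  expectation for every \<open>N\<close> in between, in particular for both extremes.\<close>

lemma cond_exp_inside_event:
  assumes A: "A \<in> sets (config_algebra M X (inside K))"
    and N: "space N = space M" "sets K_algebra \<subseteq> sets N" "sets N \<subseteq> sets exterior_algebra"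
  shows "AE \<omega> in M. real_cond_exp M N (indicator A) \<omega> =
    (\<Sum>t\<in>traces. prob (A \<inter> on_K t) / prob (on_K t) * indicator (on_K t) \<omega>)"
    (is "AE \<omega> in M. _ = ?h \<omega>")
proof -
  have subalg: "subalgebra M N"
    using N exterior_sub by (auto simp: subalgebra_def)
  interpret N: finite_measure_subalgebra M N
    by unfold_locales (rule subalg)
  have [measurable]: "A \<in> events"
    using inside_event[OF A] .
  note on_K_event [measurable]
  show ?thesis
  proof (rule N.real_cond_exp_charact)
    show "?h \<in> borel_measurable N"
      using on_K_trace[THEN subsetD[OF N(2)]]
      by (intro borel_measurable_sum borel_measurable_times borel_measurable_indicator) auto
    show "integrable M (indicator A :: 'w \<Rightarrow> real)"
      by (intro integrable_real_indicator) (auto simp: emeasure_eq_measure)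
    show "integrable M ?h"
      by (intro Bochner_Integration.integrable_sum integrable_mult_right integrable_real_indicator)
        (auto simp: emeasure_eq_measure)
    fix B assume "B \<in> sets N"
    then have BE: "B \<in> sets exterior_algebra" and [measurable]: "B \<in> events"
      using N(3) exterior_sub by auto
    have "(\<integral>\<omega>\<in>B. ?h \<omega> \<partial>M) = (\<integral>\<omega>. (\<Sum>t\<in>traces. prob (A \<inter> on_K t) / prob (on_K t) * indicator (B \<inter> on_K t) \<omega>) \<partial>M)"
      unfolding set_lebesgue_integral_def
      by (intro Bochner_Integration.integral_cong) (auto simp: sum_distrib_left indicator_def intro!: sum.cong)
    also have "\<dots> = (\<Sum>t\<in>traces. prob (A \<inter> on_K t) / prob (on_K t) * prob (B \<inter> on_K t))"
      by (subst Bochner_Integration.integral_sum)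
        (auto intro!: sum.cong integrable_mult_right integrable_real_indicator simp: emeasure_eq_measure)
    also have "\<dots> = (\<Sum>t\<in>traces. prob (A \<inter> B \<inter> on_K t))"
    proof (rule sum.cong[OF refl])
      \<comment> \<open>For a null trace the quotient is 0 by convention, and the right-hand side
        vanishes as well.\<close>
      fix t
      have "prob (A \<inter> B \<inter> on_K t) \<le> prob (on_K t)"
        by (intro finite_measure_mono) auto
      then have "prob (A \<inter> B \<inter> on_K t) = 0" if "prob (on_K t) = 0"
        using that by (metis measure_nonneg order_antisym)
      then show "prob (A \<inter> on_K t) / prob (on_K t) * prob (B \<inter> on_K t) = prob (A \<inter> B \<inter> on_K t)"
        using exterior_conditional_independence[OF A BE, of t]
        by (cases "prob (on_K t) = 0") (auto simp: field_simps)
    qed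
    also have "\<dots> = prob (\<Union>t\<in>traces. A \<inter> B \<inter> on_K t)"
    proof (rule finite_measure_finite_Union[OF finite_traces, symmetric])
      show "disjoint_family_on (\<lambda>t. A \<inter> B \<inter> on_K t) traces"
        by (auto simp: disjoint_family_on_def on_K_def)
    qed auto
    also have "(\<Union>t\<in>traces. A \<inter> B \<inter> on_K t) = A \<inter> B"
      using restrict_K_traces sets.sets_into_space[OF \<open>B \<in> events\<close>] by (auto simp: on_K_def)
    also have "prob (A \<inter> B) = (\<integral>\<omega>\<in>B. indicator A \<omega> \<partial>M)"
      unfolding set_lebesgue_integral_def by (simp add: indicator_inter_arith[symmetric] Int_commute)
    finally show "(\<integral>\<omega>\<in>B. indicator A \<omega> \<partial>M) = (\<integral>\<omega>\<in>B. ?h \<omega> \<partial>M)" ..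
  qed
qed

theorem cond_exp_inside_exterior_eq_trace:
  assumes "A \<in> sets (config_algebra M X (inside K))"
  shows "AE \<omega> in M. real_cond_exp M exterior_algebra (indicator A) \<omega> = real_cond_exp M K_algebra (indicator A) \<omega>"
  using cond_exp_inside_event[OF assms space_config_algebra trace_sub_exterior order_refl]
    cond_exp_inside_event[OF assms space_trace order_refl trace_sub_exterior]
  by eventually_elim (simp only:)

end

theorem mainTheorem5:
  fixes T :: "point set set"
    and act :: "point set \<Rightarrow> real"
    and k :: nat
    and \<alpha>V :: real
    and M :: "'w measure"
    and X :: "'w \<Rightarrow> config"
    and \<theta> :: "real \<Rightarrow> point"
  assumes "regular_tessellation T"
    and "\<forall>l\<in>T. 0 < act l \<and> act l < 1"
    and "k \<ge> 2"
    and "0 \<le> \<alpha>V" and "\<alpha>V \<le> 1"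
    and "whole_plane_field T act k \<alpha>V M X"
    and "valid_path \<theta>" and "simple_path \<theta>" and "pathfinish \<theta> = pathstart \<theta>"
    and "path_image \<theta> \<inter> nodes T = {}"
  shows "\<forall>A \<in> sets (config_algebra M X (inside (path_image \<theta>))).
           AE \<omega> in M.
             real_cond_exp M (config_algebra M X (- inside (path_image \<theta>))) (indicator A) \<omega> =
             real_cond_exp M (trace_algebra T M X (path_image \<theta>)) (indicator A) \<omega>"
proof -
  have "prob_space M"
    using assms(6) by (simp add: whole_plane_field_def)
  then have "polygonal_plane_compact T M act k \<alpha>V X (path_image \<theta>)"
    using assms by (intro polygonal_plane_compact.intro polygonal_plane.intro tessellation.intro
        polygonal_plane_axioms.intro polygonal_plane_compact_axioms.intro)
      (auto intro: compact_path_image simple_path_imp_path)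
  then show ?thesis
    using polygonal_plane_compact.cond_exp_inside_exterior_eq_trace by blast
qed

end
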